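(* When the contexts are stochastic, there exists an algorithm that runs in $\mathrm{poly}(m,M,|\mathcal V|)$ space and per-round time and achieves $\mathsf{REG}_{sto}\le O(M\sqrt{mT\log M})$ under full information feedback.
   Context: A uniform price auction selling $K$ identical units is repeated over $T$ rounds ($T$ known), with competing bids $\boldsymbol\beta_-^1,\dots,\boldsymbol\beta_-^T$ fixed in advance by an oblivious adversary. $\mathcal V$ is a finite set of valuation vectors $\mathbf v=(v_1,\dots,v_M)$ with $1\ge v_1\ge\dots\ge v_M\ge0$; for $\mathbf v$ let $w_j(\mathbf v)=\frac1j\sum_{\ell\le j}v_\ell$. An $m$-uniform strategy $\langle(b_1,q_1),\dots,(b_m,q_m)\rangle$ ($b_1>\dots>b_m>0$, positive integer $q_j$, $Q_j=\sum_{\ell\le j}q_\ell\le M$) is the bid vector with $q_1$ copies of $b_1$, then $q_2$ copies of $b_2$, etc. $\overline{\mathcal P}_{\le m}(\mathbf v)$ is the set of $k$-uniform strategies, $k\le m$, with $b_\ell=w_{Q_\ell}(\mathbf v)$. With competing bids $\boldsymbol\beta_-$, the $K$ highest bids win a unit each (ties in favor of the bidder), $x$ is the bidder's number of winning bids, and the value in a round with valuation $\mathbf v$ is $V(\mathbf b;\boldsymbol\beta_-)=\sum_{j\le x}v_j$. In each round $t$ a context $\mathbf v^t\in\mathcal V$ is drawn i.i.d. from an unknown distribution $F_{\mathbf v}$ and revealed; the learner submits $\mathbf b^t\in\overline{\mathcal P}_{\le m}(\mathbf v^t)$ and then observes $\boldsymbol\beta_-^t$. $\Pi$ is the set of maps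 $\pi$ on $\mathcal V$ with $\pi(\mathbf v)\in\overline{\mathcal P}_{\le m}(\mathbf v)$. $\mathsf{REG}_{sto}=\max_{\pi\in\Pi}\sum_{t=1}^T\mathbb E_{\mathbf v^t\sim F_{\mathbf v}}[V(\pi(\mathbf v^t);\boldsymbol\beta_-^t)]-\sum_{t=1}^T\mathbb E[V(\mathbf b^t;\boldsymbol\beta_-^t)]$, where values are computed with the round's valuation. *)

theory Defs
  imports "HOL-Probability.Probability"
begin

section \<open>Uniform price auctions and uniform bidding strategies\<close>

text \<open>
  Vectors are lists and hence indexed from 0: the paper's $v_j$ is \<open>v ! (j - 1)\<close>.
  A strategy $\langle(b_1,q_1),\dots,(b_k,q_k)\rangle$ is the list of its pairs.
\<close>

type_synonym valuation = "real list"
type_synonym strategy = "(real \<times> nat) list"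

definition valuations :: "nat \<Rightarrow> valuation set" where
  "valuations M = {v. length v = M \<and> sorted_wrt (\<ge>) v \<and> (\<forall>x\<in>set v. 0 \<le> x \<and> x \<le> 1)}"

definition avg_value :: "valuation \<Rightarrow> nat \<Rightarrow> real" where
  "avg_value v j = sum_list (take j v) / real j"

definition uniform_strategies :: "nat \<Rightarrow> nat \<Rightarrow> strategy set" where
  "uniform_strategies M k =
     {s. length s = k \<and> sorted_wrt (>) (map fst s) \<and>
         (\<forall>(b, q)\<in>set s. b > 0 \<and> q > 0) \<and> sum_list (map snd s) \<le> M}"

definition bid_vector :: "strategy \<Rightarrow> real list" where
  "bid_vector s = concat (map (\<lambda>(b, q). replicate q b) s)"

text \<open>The set $\overline{\mathcal P}_{\le m}(\mathbf v)$.\<close>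

definition avg_strategies :: "nat \<Rightarrow> valuation \<Rightarrow> strategy set" where
  "avg_strategies m v =
     (\<Union>k\<in>{1..m}. {s \<in> uniform_strategies (length v) k.
        \<forall>l<k. fst (s ! l) = avg_value v (sum_list (take (Suc l) (map snd s)))})"

text \<open>
  Bids have to be positive, so $\overline{\mathcal P}_{\le m}(\mathbf v)$ is empty for
  $\mathbf v = 0$ (and only then, if $m, M \ge 1$).  In that degenerate case the bidder
  submits no bid at all; every strategy has value 0 there.
\<close>

definition admissible :: "nat \<Rightarrow> valuation \<Rightarrow> strategy set" where
  "admissible m v = (if avg_strategies m v = {} then {[]} else avg_strategies m v)"

text \<open>
  The \<open>j\<close>-th own bid is among the \<open>K\<close> highest bids, ties being resolved in favor of the
  bidder, iff its rank is at most \<open>K\<close>; ranked ahead of it are the earlier entries of the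
  (nonincreasing) own bid vector and the strictly larger competing bids.
\<close>

definition units_won :: "nat \<Rightarrow> real list \<Rightarrow> real list \<Rightarrow> nat" where
  "units_won K b \<beta> =
     card {j. j < length b \<and> j + length (filter (\<lambda>c. c > b ! j) \<beta>) + 1 \<le> K}"

definition auction_value :: "nat \<Rightarrow> valuation \<Rightarrow> strategy \<Rightarrow> real list \<Rightarrow> real" where
  "auction_value K v s \<beta> = sum_list (take (units_won K (bid_vector s) \<beta>) v)"

text \<open>
  The competing bids of a round.  Listing them in nonincreasing order lets an algorithm whose
  running time does not depend on \<open>K\<close> access them by rank.
\<close>

definition competing_bids :: "real list set" where
  "competing_bids = {\<beta>. sorted_wrt (\<ge>) \<beta> \<and> (\<forall>c\<in>set \<beta>. 0 \<le> c)}"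

text \<open>The learning problem: everything the learner knows in advance.\<close>

record problem =
  strat_bound :: nat   \<comment> \<open>\<open>m\<close>\<close>
  demand :: nat        \<comment> \<open>\<open>M\<close>\<close>
  units :: nat        \<comment> \<open>\<open>K\<close>\<close>
  horizon :: nat       \<comment> \<open>\<open>T\<close>\<close>
  contexts :: "valuation list"   \<comment> \<open>an enumeration of the set of valuations\<close>

definition valid_problem :: "problem \<Rightarrow> bool" where
  "valid_problem P \<longleftrightarrow>
     1 \<le> strat_bound P \<and> 1 \<le> demand P \<and> 1 \<le> units P \<and> 1 \<le> horizon P \<and>
     distinct (contexts P) \<and> set (contexts P) \<subseteq> valuations (demand P)"


section \<open>Randomized real-RAM programs\<close>

text \<open>
  Algorithms are finite programs of a deeply embedded imperative language, so that a single
  program has to work for all problems.  The machine is the usual unit-cost real RAM: a memory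
  cell holds a natural number or a real number, elementary real operations (including
  \<open>exp\<close>, \<open>ln\<close>, \<open>sqrt\<close>) are exact, and a coin with given bias can be flipped.  There is no
  conversion from reals to naturals, and naturals can only be added and subtracted.
  All loops are bounded, which only restricts the algorithms available.

  Memory cells are addressed by an array name and a list of indices (a scalar is an array
  without indices).  Out-of-range reads of an input array yield 0.
\<close>

type_synonym cell = "string \<times> nat list"

datatype nat_input = In_StratBound | In_Demand | In_Supply | In_Horizon | In_NumContexts

datatype nexp =
    NLit nat
  | NInput nat_input
  | NCell string "nexp list"
  | NAdd nexp nexp
  | NSub nexp nexp

datatype rexp =
    RNat nexp
  | RContext nexp nexp     \<comment> \<open>entry of a valuation in the enumeration of all contexts\<close>
  | RCurrent nexp          \<comment> \<open>entry of the valuation of the current round\<close>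
  | RCompeting nexp        \<comment> \<open>competing bid of the current round\<close>
  | RCell string "nexp list"
  | RAdd rexp rexp
  | RSub rexp rexp
  | RMul rexp rexp
  | RDiv rexp rexp
  | RExp rexp
  | RLn rexp
  | RSqrt rexp

datatype bexp =
    NLe nexp nexp
  | RLe rexp rexp
  | BNot bexp
  | BAnd bexp bexp

datatype com =
    Skip
  | NAssign string "nexp list" nexp
  | RAssign string "nexp list" rexp
  | Flip string "nexp list" rexp   \<comment> \<open>store 1 with the given probability, and 0 otherwise\<close>
  | Seq com com
  | Cond bexp com com
  | For string nexp com            \<comment> \<open>the counter runs through \<open>0, \<dots>, n - 1\<close>\<close>

text \<open>The read-only input available to a program run.\<close>

record input =
  in_problem :: problem
  in_current :: valuation
  in_competing :: "real list"

text \<open>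
  Besides the memory, a configuration records the number of elementary steps made and the cells
  written so far; no cell is ever released, so the latter bounds the space in use at any time.
\<close>

record config =
  nmem :: "cell \<Rightarrow> nat"
  rmem :: "cell \<Rightarrow> real"
  nwritten :: "cell set"
  rwritten :: "cell set"
  steps :: nat

definition init_config :: config where
  "init_config = \<lparr>nmem = (\<lambda>_. 0), rmem = (\<lambda>_. 0), nwritten = {}, rwritten = {}, steps = 0\<rparr>"

definition space_used :: "config \<Rightarrow> nat" where
  "space_used \<sigma> = card (nwritten \<sigma>) + card (rwritten \<sigma>)"

definition tick :: "config \<Rightarrow> config" where
  "tick \<sigma> = \<sigma>\<lparr>steps := Suc (steps \<sigma>)\<rparr>"

definition nwrite :: "cell \<Rightarrow> nat \<Rightarrow> config \<Rightarrow> config" where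
  "nwrite c x \<sigma> = \<sigma>\<lparr>nmem := (nmem \<sigma>)(c := x), nwritten := insert c (nwritten \<sigma>)\<rparr>"

definition rwrite :: "cell \<Rightarrow> real \<Rightarrow> config \<Rightarrow> config" where
  "rwrite c x \<sigma> = \<sigma>\<lparr>rmem := (rmem \<sigma>)(c := x), rwritten := insert c (rwritten \<sigma>)\<rparr>"

primrec nat_input_value :: "problem \<Rightarrow> nat_input \<Rightarrow> nat" where
  "nat_input_value P In_StratBound = strat_bound P"
| "nat_input_value P In_Demand = demand P"
| "nat_input_value P In_Supply = units P"
| "nat_input_value P In_Horizon = horizon P"
| "nat_input_value P In_NumContexts = length (contexts P)"

definition entry :: "real list \<Rightarrow> nat \<Rightarrow> real" where
  "entry xs i = (if i < length xs then xs ! i else 0)"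

primrec neval :: "input \<Rightarrow> config \<Rightarrow> nexp \<Rightarrow> nat" where
  "neval I \<sigma> (NLit n) = n"
| "neval I \<sigma> (NInput a) = nat_input_value (in_problem I) a"
| "neval I \<sigma> (NCell x is) = nmem \<sigma> (x, map (neval I \<sigma>) is)"
| "neval I \<sigma> (NAdd e f) = neval I \<sigma> e + neval I \<sigma> f"
| "neval I \<sigma> (NSub e f) = neval I \<sigma> e - neval I \<sigma> f"

primrec reval :: "input \<Rightarrow> config \<Rightarrow> rexp \<Rightarrow> real" where
  "reval I \<sigma> (RNat e) = real (neval I \<sigma> e)"
| "reval I \<sigma> (RContext e f) =
     (let i = neval I \<sigma> e; vs = contexts (in_problem I)
      in if i < length vs then entry (vs ! i) (neval I \<sigma> f) else 0)"
| "reval I \<sigma> (RCurrent e) = entry (in_current I) (neval I \<sigma> e)"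
| "reval I \<sigma> (RCompeting e) = entry (in_competing I) (neval I \<sigma> e)"
| "reval I \<sigma> (RCell x is) = rmem \<sigma> (x, map (neval I \<sigma>) is)"
| "reval I \<sigma> (RAdd e f) = reval I \<sigma> e + reval I \<sigma> f"
| "reval I \<sigma> (RSub e f) = reval I \<sigma> e - reval I \<sigma> f"
| "reval I \<sigma> (RMul e f) = reval I \<sigma> e * reval I \<sigma> f"
| "reval I \<sigma> (RDiv e f) = reval I \<sigma> e / reval I \<sigma> f"
| "reval I \<sigma> (RExp e) = exp (reval I \<sigma> e)"
| "reval I \<sigma> (RLn e) = ln (reval I \<sigma> e)"
| "reval I \<sigma> (RSqrt e) = sqrt (reval I \<sigma> e)"

primrec beval :: "input \<Rightarrow> config \<Rightarrow> bexp \<Rightarrow> bool" where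
  "beval I \<sigma> (NLe e f) \<longleftrightarrow> neval I \<sigma> e \<le> neval I \<sigma> f"
| "beval I \<sigma> (RLe e f) \<longleftrightarrow> reval I \<sigma> e \<le> reval I \<sigma> f"
| "beval I \<sigma> (BNot b) \<longleftrightarrow> \<not> beval I \<sigma> b"
| "beval I \<sigma> (BAnd b c) \<longleftrightarrow> beval I \<sigma> b \<and> beval I \<sigma> c"

primrec iterate_pmf :: "(nat \<Rightarrow> 'a \<Rightarrow> 'a pmf) \<Rightarrow> nat \<Rightarrow> 'a \<Rightarrow> 'a pmf" where
  "iterate_pmf f 0 x = return_pmf x"
| "iterate_pmf f (Suc n) x = bind_pmf (iterate_pmf f n x) (f n)"

text \<open>
  Each assignment, coin flip, test and loop iteration counts as one step: the expressions of a
  program have a fixed size, so charging for their evaluation would only change the number of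
  steps by a constant factor.
\<close>

primrec exec :: "input \<Rightarrow> com \<Rightarrow> config \<Rightarrow> config pmf" where
  "exec I Skip = return_pmf"
| "exec I (NAssign x is e) =
     (\<lambda>\<sigma>. return_pmf (nwrite (x, map (neval I \<sigma>) is) (neval I \<sigma> e) (tick \<sigma>)))"
| "exec I (RAssign x is e) =
     (\<lambda>\<sigma>. return_pmf (rwrite (x, map (neval I \<sigma>) is) (reval I \<sigma> e) (tick \<sigma>)))"
| "exec I (Flip x is e) =
     (\<lambda>\<sigma>. map_pmf (\<lambda>r. nwrite (x, map (neval I \<sigma>) is) (of_bool r) (tick \<sigma>))
           (bernoulli_pmf (reval I \<sigma> e)))"
| "exec I (Seq c d) = (\<lambda>\<sigma>. bind_pmf (exec I c \<sigma>) (exec I d))"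
| "exec I (Cond b c d) = (\<lambda>\<sigma>. if beval I \<sigma> b then exec I c (tick \<sigma>) else exec I d (tick \<sigma>))"
| "exec I (For x e c) =
     (\<lambda>\<sigma>. iterate_pmf (\<lambda>i \<rho>. exec I c (nwrite (x, []) i (tick \<rho>))) (neval I \<sigma> e) (tick \<sigma>))"


section \<open>Repeated auctions with stochastic contexts\<close>

text \<open>
  In each round, \<open>bid_prog\<close> is run when the context has been revealed and \<open>update_prog\<close> when
  the competing bids have been observed.  The memory persists between the rounds and is
  initially 0.
\<close>

record algorithm =
  bid_prog :: com
  update_prog :: com

text \<open>The strategy submitted is read off from fixed output cells.\<close>

definition submitted :: "config \<Rightarrow> strategy" where
  "submitted \<sigma> =
     map (\<lambda>l. (rmem \<sigma> (''bid'', [l]), nmem \<sigma> (''quantity'', [l]))) [0..<nmem \<sigma> (''length'', [])]"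

definition bid_input :: "problem \<Rightarrow> valuation \<Rightarrow> input" where
  "bid_input P v = \<lparr>in_problem = P, in_current = v, in_competing = []\<rparr>"

definition update_input :: "problem \<Rightarrow> valuation \<Rightarrow> real list \<Rightarrow> input" where
  "update_input P v \<beta> = \<lparr>in_problem = P, in_current = v, in_competing = \<beta>\<rparr>"

text \<open>
  Joint distribution of the context of a round and the configuration after bidding, given the
  distribution of the configuration before the round.  The context is drawn independently of
  the past, and the step counter is restarted.
\<close>

definition bid_phase ::
  "algorithm \<Rightarrow> problem \<Rightarrow> valuation pmf \<Rightarrow> config pmf \<Rightarrow> (valuation \<times> config) pmf" where
  "bid_phase A P F S =
     do {
       \<sigma> \<leftarrow> S;
       v \<leftarrow> F;
       \<rho> \<leftarrow> exec (bid_input P v) (bid_prog A) (\<sigma>\<lparr>steps := 0\<rparr>);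
       return_pmf (v, \<rho>)
     }"

text \<open>
  Distribution of the configuration after \<open>t\<close> rounds.  The adversary is oblivious: its choice
  \<open>\<beta> :: nat \<Rightarrow> real list\<close> is fixed in advance; rounds are numbered from 0.
\<close>

primrec after_rounds ::
  "algorithm \<Rightarrow> problem \<Rightarrow> valuation pmf \<Rightarrow> (nat \<Rightarrow> real list) \<Rightarrow> nat \<Rightarrow> config pmf" where
  "after_rounds A P F \<beta> 0 = return_pmf init_config"
| "after_rounds A P F \<beta> (Suc t) =
     do {
       (v, \<rho>) \<leftarrow> bid_phase A P F (after_rounds A P F \<beta> t);
       exec (update_input P v (\<beta> t)) (update_prog A) \<rho>
     }"

definition bids_in_round ::
  "algorithm \<Rightarrow> problem \<Rightarrow> valuation pmf \<Rightarrow> (nat \<Rightarrow> real list) \<Rightarrow> nat \<Rightarrow> (valuation \<times> strategy) pmf"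
  where
  "bids_in_round A P F \<beta> t =
     map_pmf (\<lambda>(v, \<rho>). (v, submitted \<rho>)) (bid_phase A P F (after_rounds A P F \<beta> t))"

text \<open>The class $\Pi$ of maps from contexts to strategies.\<close>

definition policies :: "problem \<Rightarrow> (valuation \<Rightarrow> strategy) set" where
  "policies P = (\<Pi>\<^sub>E v\<in>set (contexts P). admissible (strat_bound P) v)"

definition policy_value ::
  "problem \<Rightarrow> valuation pmf \<Rightarrow> (nat \<Rightarrow> real list) \<Rightarrow> (valuation \<Rightarrow> strategy) \<Rightarrow> real" where
  "policy_value P F \<beta> \<pi> =
     (\<Sum>t<horizon P. measure_pmf.expectation F (\<lambda>v. auction_value (units P) v (\<pi> v) (\<beta> t)))"

definition algorithm_value ::
  "algorithm \<Rightarrow> problem \<Rightarrow> valuation pmf \<Rightarrow> (nat \<Rightarrow> real list) \<Rightarrow> real" where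
  "algorithm_value A P F \<beta> =
     (\<Sum>t<horizon P. measure_pmf.expectation (bids_in_round A P F \<beta> t)
        (\<lambda>(v, s). auction_value (units P) v s (\<beta> t)))"

definition stochastic_regret ::
  "algorithm \<Rightarrow> problem \<Rightarrow> valuation pmf \<Rightarrow> (nat \<Rightarrow> real list) \<Rightarrow> real" where
  "stochastic_regret A P F \<beta> =
     (MAX \<pi>\<in>policies P. policy_value P F \<beta> \<pi>) - algorithm_value A P F \<beta>"

text \<open>The maximum in the regret is attained.\<close>

lemma finite_avg_strategies: "finite (avg_strategies m v)"
proof -
  let ?g = "\<lambda>qs. map (\<lambda>l. (avg_value v (sum_list (take (Suc l) qs)), qs ! l)) [0..<length qs]"
  let ?Q = "{qs. set qs \<subseteq> {..length v} \<and> length qs \<le> m}"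
  have "avg_strategies m v \<subseteq> ?g ` ?Q"
  proof
    fix s assume "s \<in> avg_strategies m v"
    then have len: "length s \<le> m" and sum: "sum_list (map snd s) \<le> length v"
      and avg: "\<forall>l<length s. fst (s ! l) = avg_value v (sum_list (take (Suc l) (map snd s)))"
      by (auto simp: avg_strategies_def uniform_strategies_def)
    have "x \<le> length v" if "x \<in> set (map snd s)" for x
      using member_le_sum_list[OF that] sum by linarith
    then have "map snd s \<in> ?Q"
      using len by auto
    moreover have "s = ?g (map snd s)"
      using avg by (intro nth_equalityI) (auto simp: prod_eq_iff)
    ultimately show "s \<in> ?g ` ?Q"
      by blast
  qed
  moreover have "finite ?Q"
    by (rule finite_lists_length_le) simp
  ultimately show ?thesis
    by (meson finite_imageI finite_subset)
qed

lemma finite_policies: "finite (policies P)"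
  by (auto simp: policies_def admissible_def finite_avg_strategies intro!: finite_PiE)

lemma policies_nonempty: "policies P \<noteq> {}"
  by (auto simp: policies_def admissible_def PiE_eq_empty_iff)

end

theory Submission
  imports Defs
begin

text \<open>
  A strategy in $\overline{\mathcal P}_{\le m}(\mathbf v)$ is a path $0 < Q_1 < \dots < Q_k \le M$
  with $k \le m$ edges, where an edge $(a, b)$ stands for $b - a$ bids of $w_b(\mathbf v)$.  Since the
  winning bids form a prefix of the bid vector, the value of a strategy is the sum over its edges
  of a gain that depends on $(a, b)$ and $\boldsymbol\beta_-$ only.  Under full information these gains can be
  computed for all contexts in every round, so Hedge over paths is run for each context
  separately: a dynamic program over the edges sums the exponential weights of all paths, and
  the path is sampled node by node with conditional probabilities read off from that program.
  There are at most $(M+1)^m$ paths, so every single context has regret $O(M\sqrt{mT\log M})$, hence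
  so has their average.  For $M = 1$ the bound is 0 and there is at most one strategy.
\<close>

section \<open>Program logic\<close>

text \<open>A policy chooses its strategy for each context separately, so the regret splits into an
  average over F of regrets for one fixed context. For this split to apply to the learner, its
  behaviour on a context must not depend on which contexts were drawn before. It does not: every
  round updates the gains of every context, so the accumulated gains are a deterministic function of
  the competing bids. Past contexts and coin flips thus vanish from the law of the bids, and F
  enters only as an averaging measure. The resource bounds may not depend on K or T. Hence T occurs
  only in the learning rate, K only in comparisons and as a rank among the competing bids, and
  indices are formed by subtraction. Most facts about programs concern all reachable configurations
  (\<open>wp\<close>); only the sampling loop needs an exact law. The constant 3 rounds up 2 + 1/2:
  for M >= 2 there are at most (M+1)^m <= M^(2m) paths, which costs 2 m ln M in Hedge, and its
  quadratic term contributes 1/2.\<close>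

definition wp :: "input \<Rightarrow> com \<Rightarrow> (config \<Rightarrow> bool) \<Rightarrow> config \<Rightarrow> bool" where
  "wp I c Q \<sigma> \<longleftrightarrow> (\<forall>\<rho>\<in>set_pmf (exec I c \<sigma>). Q \<rho>)"

lemma wp_mono: "wp I c R \<sigma> \<Longrightarrow> (\<And>\<rho>. R \<rho> \<Longrightarrow> Q \<rho>) \<Longrightarrow> wp I c Q \<sigma>"
  by (auto simp: wp_def)

lemma wp_simps [simp]:
  "wp I Skip Q \<sigma> \<longleftrightarrow> Q \<sigma>"
  "wp I (NAssign x js e) Q \<sigma> \<longleftrightarrow> Q (nwrite (x, map (neval I \<sigma>) js) (neval I \<sigma> e) (tick \<sigma>))"
  "wp I (RAssign x js r) Q \<sigma> \<longleftrightarrow> Q (rwrite (x, map (neval I \<sigma>) js) (reval I \<sigma> r) (tick \<sigma>))"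
  "wp I (Seq c d) Q \<sigma> \<longleftrightarrow> wp I c (wp I d Q) \<sigma>"
  "wp I (Cond b c d) Q \<sigma> \<longleftrightarrow> (if beval I \<sigma> b then wp I c Q (tick \<sigma>) else wp I d Q (tick \<sigma>))"
  by (auto simp: wp_def)

lemma wp_Flip:
  "(\<And>z. Q (nwrite (x, map (neval I \<sigma>) js) (of_bool z) (tick \<sigma>))) \<Longrightarrow> wp I (Flip x js e) Q \<sigma>"
  by (auto simp: wp_def)

lemma wp_For:
  assumes "Inv 0 (tick \<sigma>)"
    and step: "\<And>i \<rho>. i < neval I \<sigma> e \<Longrightarrow> Inv i \<rho> \<Longrightarrow> wp I c (Inv (Suc i)) (nwrite (x, []) i (tick \<rho>))"
    and post: "\<And>\<rho>. Inv (neval I \<sigma> e) \<rho> \<Longrightarrow> Q \<rho>"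
  shows "wp I (For x e c) Q \<sigma>"
proof -
  let ?f = "\<lambda>i \<rho>. exec I c (nwrite (x, []) i (tick \<rho>))"
  have "\<forall>\<rho>\<in>set_pmf (iterate_pmf ?f n (tick \<sigma>)). Inv n \<rho>" if "n \<le> neval I \<sigma> e" for n
    using that
  proof (induction n)
    case 0
    then show ?case using assms(1) by simp
  next
    case (Suc n)
    then show ?case using step[of n] by (auto simp: wp_def)
  qed
  then show ?thesis
    using post by (auto simp: wp_def)
qed

lemma mem_simps [simp]:
  "nmem (tick \<sigma>) = nmem \<sigma>" "rmem (tick \<sigma>) = rmem \<sigma>"
  "nwritten (tick \<sigma>) = nwritten \<sigma>" "rwritten (tick \<sigma>) = rwritten \<sigma>"
  "steps (tick \<sigma>) = Suc (steps \<sigma>)"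
  "nmem (nwrite c x \<sigma>) = (nmem \<sigma>)(c := x)" "rmem (nwrite c x \<sigma>) = rmem \<sigma>"
  "nwritten (nwrite c x \<sigma>) = insert c (nwritten \<sigma>)" "rwritten (nwrite c x \<sigma>) = rwritten \<sigma>"
  "steps (nwrite c x \<sigma>) = steps \<sigma>"
  "nmem (rwrite c y \<sigma>) = nmem \<sigma>" "rmem (rwrite c y \<sigma>) = (rmem \<sigma>)(c := y)"
  "nwritten (rwrite c y \<sigma>) = nwritten \<sigma>" "rwritten (rwrite c y \<sigma>) = insert c (rwritten \<sigma>)"
  "steps (rwrite c y \<sigma>) = steps \<sigma>"
  by (simp_all add: tick_def nwrite_def rwrite_def)

primrec nvars :: "com \<Rightarrow> string set" where
  "nvars Skip = {}"
| "nvars (NAssign x js e) = {x}"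
| "nvars (RAssign x js r) = {}"
| "nvars (Flip x js r) = {x}"
| "nvars (Seq c d) = nvars c \<union> nvars d"
| "nvars (Cond b c d) = nvars c \<union> nvars d"
| "nvars (For x e c) = insert x (nvars c)"

primrec rvars :: "com \<Rightarrow> string set" where
  "rvars Skip = {}"
| "rvars (NAssign x js e) = {}"
| "rvars (RAssign x js r) = {x}"
| "rvars (Flip x js r) = {}"
| "rvars (Seq c d) = rvars c \<union> rvars d"
| "rvars (Cond b c d) = rvars c \<union> rvars d"
| "rvars (For x e c) = rvars c"

text \<open>Frames are tracked by array name only, ignoring indices: coarse, but computable from the
  program text.\<close>

definition agree_off :: "string set \<Rightarrow> string set \<Rightarrow> config \<Rightarrow> config \<Rightarrow> bool" where
  "agree_off X Y \<sigma> \<rho> \<longleftrightarrow>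
     (\<forall>x js. x \<notin> X \<longrightarrow> nmem \<rho> (x, js) = nmem \<sigma> (x, js)) \<and>
     (\<forall>x js. x \<notin> Y \<longrightarrow> rmem \<rho> (x, js) = rmem \<sigma> (x, js))"

lemma wp_agree_off:
  assumes "nvars c \<subseteq> X" "rvars c \<subseteq> Y" "agree_off X Y \<sigma>\<^sub>0 \<sigma>"
  shows "wp I c (agree_off X Y \<sigma>\<^sub>0) \<sigma>"
  using assms
proof (induction c arbitrary: \<sigma>)
  case (Flip x js e)
  then show ?case by (intro wp_Flip) (auto simp: agree_off_def)
next
  case (Seq c d)
  have "wp I c (agree_off X Y \<sigma>\<^sub>0) \<sigma>"
    using Seq by simp
  then show ?case
    unfolding wp_simps by (rule wp_mono) (use Seq in auto)
next
  case (Cond b c d)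
  then show ?case by (simp add: agree_off_def)
next
  case (For x e c)
  show ?case
  proof (rule wp_For[where Inv = "\<lambda>_. agree_off X Y \<sigma>\<^sub>0"])
    fix i and \<rho> :: config assume "agree_off X Y \<sigma>\<^sub>0 \<rho>"
    with For show "wp I c (agree_off X Y \<sigma>\<^sub>0) (nwrite (x, []) i (tick \<rho>))"
      by (intro For.IH) (auto simp: agree_off_def)
  qed (use For in \<open>auto simp: agree_off_def\<close>)
qed (auto simp: agree_off_def)

text \<open>Lets the specification of a program mention only what it computes; whatever it leaves
  alone follows from its syntax.\<close>

lemma wp_with_frame:
  assumes "wp I c R \<sigma>" "\<And>\<rho>. agree_off (nvars c) (rvars c) \<sigma> \<rho> \<Longrightarrow> R \<rho> \<Longrightarrow> Q \<rho>"
  shows "wp I c Q \<sigma>"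
  using assms wp_agree_off[of c "nvars c" "rvars c" \<sigma> \<sigma> I]
  by (auto simp: wp_def agree_off_def)

section \<open>Time and space\<close>

text \<open>
  No cell is released between rounds, so bounding the space means confining all writes to a fixed
  finite set of cells.  If the expressions that are stored or used as indices never add, then every
  natural number in memory stays below \<open>size_bound\<close>, and hence so does every index.
  Only a loop bound may exceed it, by one.
\<close>

primrec small :: "nexp \<Rightarrow> bool" where
  "small (NLit n) \<longleftrightarrow> n \<le> 1"
| "small (NInput a) \<longleftrightarrow> a \<in> {In_StratBound, In_Demand, In_NumContexts}"
| "small (NCell x js) \<longleftrightarrow> True"
| "small (NAdd e f) \<longleftrightarrow> False"
| "small (NSub e f) \<longleftrightarrow> small e"

fun small_bound :: "nexp \<Rightarrow> bool" where
  "small_bound (NAdd e (NLit (Suc 0))) \<longleftrightarrow> small e"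
| "small_bound e \<longleftrightarrow> small e"

primrec tame :: "com \<Rightarrow> bool" where
  "tame Skip \<longleftrightarrow> True"
| "tame (NAssign x js e) \<longleftrightarrow> (\<forall>i\<in>set js. small i) \<and> length js \<le> 3 \<and> small e"
| "tame (RAssign x js r) \<longleftrightarrow> (\<forall>i\<in>set js. small i) \<and> length js \<le> 3"
| "tame (Flip x js r) \<longleftrightarrow> (\<forall>i\<in>set js. small i) \<and> length js \<le> 3"
| "tame (Seq c d) \<longleftrightarrow> tame c \<and> tame d"
| "tame (Cond b c d) \<longleftrightarrow> tame c \<and> tame d"
| "tame (For x e c) \<longleftrightarrow> small_bound e \<and> tame c"

definition size_bound :: "problem \<Rightarrow> nat" where
  "size_bound P = strat_bound P + demand P + length (contexts P) + 1"

text \<open>Adding up both branches of a conditional, instead of taking their maximum, keeps the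
  cost a plain polynomial in B.\<close>

primrec cost :: "nat \<Rightarrow> com \<Rightarrow> nat" where
  "cost B Skip = 0"
| "cost B (NAssign x js e) = 1"
| "cost B (RAssign x js r) = 1"
| "cost B (Flip x js r) = 1"
| "cost B (Seq c d) = cost B c + cost B d"
| "cost B (Cond b c d) = 1 + cost B c + cost B d"
| "cost B (For x e c) = 1 + (B + 1) * (1 + cost B c)"

text \<open>Every index list that a tame program could address, written or not. The cap on the
  length makes this set finite and its size cubic in B.\<close>

definition cells :: "string set \<Rightarrow> nat \<Rightarrow> cell set" where
  "cells X B = {(x, js). x \<in> X \<and> set js \<subseteq> {..B} \<and> length js \<le> 3}"

definition bounded_config :: "nat \<Rightarrow> string set \<Rightarrow> string set \<Rightarrow> config \<Rightarrow> bool" where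
  "bounded_config B X Y \<sigma> \<longleftrightarrow>
     (\<forall>c. nmem \<sigma> c \<le> B) \<and> nwritten \<sigma> \<subseteq> cells X B \<and> rwritten \<sigma> \<subseteq> cells Y B"

lemma small_neval:
  assumes "small e" "\<forall>c. nmem \<sigma> c \<le> size_bound (in_problem I)"
  shows "neval I \<sigma> e \<le> size_bound (in_problem I)"
  using assms by (induction e) (auto simp: size_bound_def)

lemma small_bound_neval:
  assumes "small_bound e" "\<forall>c. nmem \<sigma> c \<le> size_bound (in_problem I)"
  shows "neval I \<sigma> e \<le> Suc (size_bound (in_problem I))"
proof (cases "\<exists>e'. e = NAdd e' (NLit (Suc 0))")
  case True
  then show ?thesis using assms small_neval[of _ \<sigma> I] by auto
next
  case False
  then have "small_bound e = small e"
    by (cases e rule: small_bound.cases) auto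
  then show ?thesis using assms small_neval[of e \<sigma> I] by auto
qed

lemma bounded_nwrite:
  "bounded_config B X Y \<sigma> \<Longrightarrow> x \<in> X \<Longrightarrow> set js \<subseteq> {..B} \<Longrightarrow> length js \<le> 3 \<Longrightarrow> n \<le> B \<Longrightarrow>
   bounded_config B X Y (nwrite (x, js) n (tick \<sigma>))"
  by (auto simp: bounded_config_def cells_def)

lemma bounded_rwrite:
  "bounded_config B X Y \<sigma> \<Longrightarrow> x \<in> Y \<Longrightarrow> set js \<subseteq> {..B} \<Longrightarrow> length js \<le> 3 \<Longrightarrow>
   bounded_config B X Y (rwrite (x, js) r (tick \<sigma>))"
  by (auto simp: bounded_config_def cells_def)

text \<open>Time and space need each other: loop bounds are small only while the stored numbers are,
  and the counters stay below B only because a loop makes at most B + 1 iterations. Hence one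
  induction for both.\<close>

lemma wp_tame:
  assumes "tame c" "nvars c \<subseteq> X" "rvars c \<subseteq> Y" "B = size_bound (in_problem I)"
    and "bounded_config B X Y \<sigma>"
  shows "wp I c (\<lambda>\<rho>. bounded_config B X Y \<rho> \<and> steps \<rho> \<le> steps \<sigma> + cost B c) \<sigma>"
  using assms
proof (induction c arbitrary: \<sigma>)
  case (NAssign x js e)
  then have "\<forall>c. nmem \<sigma> c \<le> B" by (simp add: bounded_config_def)
  with NAssign show ?case
    by (auto simp: subset_iff intro!: bounded_nwrite small_neval)
next
  case (RAssign x js e)
  then have "\<forall>c. nmem \<sigma> c \<le> B" by (simp add: bounded_config_def)
  with RAssign show ?case
    by (auto simp: subset_iff intro!: bounded_rwrite small_neval)
next
  case (Flip x js e)
  then have "\<forall>c. nmem \<sigma> c \<le> B" by (simp add: bounded_config_def)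
  moreover have "B \<ge> 1" using Flip by (simp add: size_bound_def)
  ultimately show ?case using Flip
    by (auto simp: subset_iff intro!: wp_Flip bounded_nwrite small_neval)
next
  case (Seq c d)
  show ?case
    unfolding wp_simps
  proof (rule wp_mono)
    show "wp I c (\<lambda>\<rho>. bounded_config B X Y \<rho> \<and> steps \<rho> \<le> steps \<sigma> + cost B c) \<sigma>"
      using Seq by simp
    fix \<rho> :: config assume "bounded_config B X Y \<rho> \<and> steps \<rho> \<le> steps \<sigma> + cost B c"
    then show "wp I d (\<lambda>\<rho>. bounded_config B X Y \<rho> \<and> steps \<rho> \<le> steps \<sigma> + cost B (Seq c d)) \<rho>"
      using Seq by (intro wp_mono[OF Seq.IH(2)]) auto
  qed
next
  case (Cond b c d)
  have "bounded_config B X Y (tick \<sigma>)" using Cond by (simp add: bounded_config_def)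
  with Cond show ?case
    using wp_mono[OF Cond.IH(1)[of "tick \<sigma>"]] wp_mono[OF Cond.IH(2)[of "tick \<sigma>"]] by simp
next
  case (For x e c)
  have "\<forall>c. nmem \<sigma> c \<le> B" using For by (simp add: bounded_config_def)
  then have n: "neval I \<sigma> e \<le> Suc B" using For small_bound_neval by simp
  show ?case
  proof (rule wp_For[where Inv = "\<lambda>i \<rho>. bounded_config B X Y \<rho> \<and> steps \<rho> \<le> Suc (steps \<sigma>) + i * (1 + cost B c)"])
    fix i and \<rho> :: config assume i: "i < neval I \<sigma> e" "bounded_config B X Y \<rho> \<and> steps \<rho> \<le> Suc (steps \<sigma>) + i * (1 + cost B c)"
    then have "bounded_config B X Y (nwrite (x, []) i (tick \<rho>))"
      using For.prems n by (intro bounded_nwrite) auto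
    then show "wp I c (\<lambda>\<rho>. bounded_config B X Y \<rho> \<and> steps \<rho> \<le> Suc (steps \<sigma>) + Suc i * (1 + cost B c))
            (nwrite (x, []) i (tick \<rho>))"
      by (intro wp_mono[OF For.IH]) (use For.prems i in auto)
  next
    fix \<rho> :: config assume "bounded_config B X Y \<rho> \<and> steps \<rho> \<le> Suc (steps \<sigma>) + neval I \<sigma> e * (1 + cost B c)"
    moreover have "neval I \<sigma> e * (1 + cost B c) \<le> (B + 1) * (1 + cost B c)"
      using n by (intro mult_le_mono1) simp
    ultimately show "bounded_config B X Y \<rho> \<and> steps \<rho> \<le> steps \<sigma> + cost B (For x e c)"
      by simp
  qed (use For.prems in \<open>auto simp: bounded_config_def\<close>)
qed auto



text \<open>Each loop raises the degree by one. Adding the exponents of two subprograms merely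
  provides a common exponent, as B >= 1.\<close>

lemma cost_polynomial: "\<exists>k d. \<forall>B\<ge>1. cost B c \<le> k * B ^ d"
proof (induction c)
  case (Seq c d)
  then obtain k1 d1 k2 d2 where IH: "\<forall>B\<ge>1. cost B c \<le> k1 * B ^ d1" "\<forall>B\<ge>1. cost B d \<le> k2 * B ^ d2"
    by blast
  have "cost B (Seq c d) \<le> (k1 + k2) * B ^ (d1 + d2)" if B: "1 \<le> B" for B
  proof -
    have "cost B c \<le> k1 * B ^ (d1 + d2)" "cost B d \<le> k2 * B ^ (d1 + d2)"
      using IH B by (meson le_trans le_add1 le_add2 mult_le_mono2 power_increasing)+
    then show ?thesis by (simp add: algebra_simps)
  qed
  then show ?case by blast
next
  case (Cond b c d)
  then obtain k1 d1 k2 d2 where IH: "\<forall>B\<ge>1. cost B c \<le> k1 * B ^ d1" "\<forall>B\<ge>1. cost B d \<le> k2 * B ^ d2"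
    by blast
  have "cost B (Cond b c d) \<le> (1 + k1 + k2) * B ^ (d1 + d2)" if B: "1 \<le> B" for B
  proof -
    have "cost B c \<le> k1 * B ^ (d1 + d2)" "cost B d \<le> k2 * B ^ (d1 + d2)" "1 \<le> B ^ (d1 + d2)"
      using IH B by (meson le_trans le_add1 le_add2 mult_le_mono2 power_increasing one_le_power)+
    then show ?thesis by (simp add: algebra_simps)
  qed
  then show ?case by blast
next
  case (For x e c)
  then obtain k d where IH: "\<forall>B\<ge>1. cost B c \<le> k * B ^ d" by blast
  have "cost B (For x e c) \<le> (3 + 2 * k) * B ^ Suc d" if B: "1 \<le> B" for B
  proof -
    have p: "1 \<le> B ^ d" using B by simp
    have "cost B (For x e c) \<le> 1 + (2 * B) * (B ^ d + k * B ^ d)"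
      unfolding cost.simps using IH B p by (intro add_mono mult_mono) auto
    also have "1 \<le> B * B ^ d" using B p by simp
    finally show ?thesis by (simp add: algebra_simps)
  qed
  then show ?case by blast
qed (auto intro!: exI[of _ "1::nat"])

lemma card_cells_le:
  assumes "finite X" shows "finite (cells X B)" "card (cells X B) \<le> card X * (4 * (B + 1) ^ 3)"
proof -
  have eq: "cells X B = X \<times> {js. set js \<subseteq> {..B} \<and> length js \<le> 3}"
    by (auto simp: cells_def)
  show "finite (cells X B)"
    unfolding eq using assms by (intro finite_cartesian_product finite_lists_length_le) auto
  have "card {js. set js \<subseteq> {..B} \<and> length js \<le> 3} = (\<Sum>i\<le>3. (B + 1) ^ i)"
    by (subst card_lists_length_le) simp_all
  also have "\<dots> \<le> (\<Sum>i\<le>3::nat. (B + 1) ^ 3)"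
    by (intro sum_mono power_increasing) auto
  finally have "card {js. set js \<subseteq> {..B} \<and> length js \<le> 3} \<le> 4 * (B + 1) ^ 3"
    by simp
  then show "card (cells X B) \<le> card X * (4 * (B + 1) ^ 3)"
    unfolding eq card_cartesian_product by (rule mult_le_mono2)
qed

section \<open>The algorithm\<close>

text \<open>The local form of b_1 > b_2 > ... > 0: comparing neighbours suffices by transitivity.
  Node 0 is the start and carries no bid, hence the exemption.\<close>

definition edge_ok :: "valuation \<Rightarrow> nat \<Rightarrow> nat \<Rightarrow> bool" where
  "edge_ok v a b \<longleftrightarrow> (a = 0 \<or> avg_value v b < avg_value v a) \<and> 0 < avg_value v b"

text \<open>The test says that the bid at position j wins at level w_b: at most K - (j+1) competing
  bids exceed w_b iff the competing bid with that 0-based rank does not. A missing competing bid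
  reads as 0. Summing over all positions mirrors the innermost loop of
  \<open>update\<close>.\<close>

definition edge_value :: "nat \<Rightarrow> valuation \<Rightarrow> real list \<Rightarrow> nat \<Rightarrow> nat \<Rightarrow> real" where
  "edge_value K v \<beta> a b =
     (\<Sum>j<length v. if a \<le> j \<and> Suc j \<le> b \<and> Suc j \<le> K \<and> entry \<beta> (K - Suc j) \<le> avg_value v b
                    then v ! j else 0)"

text \<open>
  The total weight of the paths that continue a path with last node \<open>a\<close> by at most \<open>k\<close> edges
  using only nodes above \<open>M - r\<close>; the two summands of the recursion differ in whether the node
  \<open>M - r\<close> is used.  The empty path is excluded by the value at \<open>a = 0\<close>.
\<close>

primrec path_total :: "nat \<Rightarrow> (nat \<Rightarrow> nat \<Rightarrow> real) \<Rightarrow> nat \<Rightarrow> nat \<Rightarrow> nat \<Rightarrow> real" where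
  "path_total M E 0 = (\<lambda>a k. if 0 < a then 1 else 0)"
| "path_total M E (Suc r) = (\<lambda>a k. path_total M E r a k +
     (if 0 < k then E a (M - r) * path_total M E r (M - r) (k - 1) else 0))"

text \<open>Up to constants this balances the two Hedge terms ln N / \<eta> and \<eta> T M^2 / 2,
  with ln N of order m ln M and gains in [0, M].\<close>

definition learning_rate :: "problem \<Rightarrow> real" where
  "learning_rate P =
     sqrt (real (strat_bound P) * ln (real (demand P)) / real (horizon P)) / real (demand P)"

text \<open>
  The cell \<open>S[i, a, b]\<close> holds the gain of the edge \<open>(a, b)\<close> accumulated so far for the \<open>i\<close>-th
  context, \<open>c\<close> the index of the current context, \<open>E[a, b]\<close> the edge weights for that context, and
  \<open>H[M - r, a, k]\<close> the number \<open>path_total M E r a k\<close>.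
\<close>

abbreviation "var x \<equiv> NCell x []"
abbreviation "lit n \<equiv> NLit n"
abbreviation "in_m \<equiv> NInput In_StratBound"
abbreviation "in_M \<equiv> NInput In_Demand"
abbreviation "in_n \<equiv> NInput In_NumContexts"
abbreviation "in_K \<equiv> NInput In_Supply"
abbreviation "in_T \<equiv> NInput In_Horizon"

text \<open>The current context is given as a vector, while the gains are stored under its index, so
  the enumeration is searched. Equality of reals is tested by two inequalities; \<open>f\<close>
  flags that all entries so far agree.\<close>

definition find_context :: com where
  "find_context =
     For ''i'' in_n
       (Seq (NAssign ''f'' [] (lit 1))
       (Seq (For ''j'' in_M
              (Cond (BAnd (RLe (RContext (var ''i'') (var ''j'')) (RCurrent (var ''j'')))
                          (RLe (RCurrent (var ''j'')) (RContext (var ''i'') (var ''j''))))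
                Skip (NAssign ''f'' [] (lit 0))))
            (Cond (NLe (lit 1) (var ''f'')) (NAssign ''c'' [] (var ''i'')) Skip)))"

text \<open>The parameter is an expression in the counter \<open>j\<close>, so that one program
  serves the current valuation and the enumerated ones. At b = 0 the division 0/0 yields 0, which
  agrees with \<open>avg_value v 0\<close> and keeps node 0 from being the end of an edge.\<close>

definition averages :: "rexp \<Rightarrow> com" where
  "averages e =
     For ''b'' (NAdd in_M (lit 1))
       (Seq (RAssign ''w'' [var ''b''] (RNat (lit 0)))
       (Seq (For ''j'' in_M
              (Cond (NLe (NAdd (var ''j'') (lit 1)) (var ''b''))
                (RAssign ''w'' [var ''b''] (RAdd (RCell ''w'' [var ''b'']) e)) Skip))
            (RAssign ''w'' [var ''b''] (RDiv (RCell ''w'' [var ''b'']) (RNat (var ''b''))))))"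

definition compute_edge_weights :: com where
  "compute_edge_weights =
     For ''a'' (NAdd in_M (lit 1)) (For ''b'' (NAdd in_M (lit 1))
       (Cond (BAnd (BNot (BAnd (NLe (lit 1) (var ''a''))
                               (RLe (RCell ''w'' [var ''a'']) (RCell ''w'' [var ''b'']))))
                   (BNot (RLe (RCell ''w'' [var ''b'']) (RNat (lit 0)))))
         (RAssign ''E'' [var ''a'', var ''b'']
           (RExp (RMul (RDiv (RSqrt (RDiv (RMul (RNat in_m) (RLn (RNat in_M))) (RNat in_T))) (RNat in_M))
                       (RCell ''S'' [var ''c'', var ''a'', var ''b'']))))
         (RAssign ''E'' [var ''a'', var ''b''] (RNat (lit 0)))))"

definition total_init :: com where
  "total_init =
     For ''a'' (NAdd in_M (lit 1)) (For ''k'' (NAdd in_m (lit 1))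
       (Cond (NLe (lit 1) (var ''a''))
         (RAssign ''H'' [in_M, var ''a'', var ''k''] (RNat (lit 1)))
         (RAssign ''H'' [in_M, var ''a'', var ''k''] (RNat (lit 0)))))"

text \<open>Layers are addressed by M - r instead of r: passing to the next layer is then a
  subtraction, as required of a \<open>small\<close> index.\<close>

definition total_step :: com where
  "total_step =
     For ''i'' in_M
       (Seq (NAssign ''b'' [] (NSub in_M (var ''i'')))
       (For ''a'' (NAdd in_M (lit 1)) (For ''k'' (NAdd in_m (lit 1))
         (Cond (NLe (lit 1) (var ''k''))
           (RAssign ''H'' [NSub (var ''b'') (lit 1), var ''a'', var ''k'']
             (RAdd (RCell ''H'' [var ''b'', var ''a'', var ''k''])
                   (RMul (RCell ''E'' [var ''a'', var ''b''])
                         (RCell ''H'' [var ''b'', var ''b'', NSub (var ''k'') (lit 1)]))))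
           (RAssign ''H'' [NSub (var ''b'') (lit 1), var ''a'', var ''k'']
             (RCell ''H'' [var ''b'', var ''a'', var ''k'']))))))"

text \<open>Since \<open>k\<close> is the number of edges still allowed, m - k is the next free
  output position, and no increasing counter has to be stored.\<close>

definition take_edge :: com where
  "take_edge =
     Cond (NLe (lit 1) (var ''x''))
       (Seq (RAssign ''bid'' [NSub in_m (var ''k'')] (RCell ''w'' [var ''b'']))
       (Seq (NAssign ''quantity'' [NSub in_m (var ''k'')] (NSub (var ''b'') (var ''a'')))
       (Seq (NAssign ''a'' [] (var ''b''))
            (NAssign ''k'' [] (NSub (var ''k'') (lit 1))))))
       Skip"

text \<open>
  The node considered in iteration \<open>i\<close> is \<open>i + 1\<close>, written without addition in order to be
  \<^const>\<open>small\<close>.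
\<close>

definition sample_step :: com where
  "sample_step =
     Seq (NAssign ''b'' [] (NSub in_M (NSub (NSub in_M (lit 1)) (var ''i''))))
       (Cond (NLe (lit 1) (var ''k''))
         (Seq (Flip ''x'' []
                (RDiv (RMul (RCell ''E'' [var ''a'', var ''b''])
                            (RCell ''H'' [var ''b'', var ''b'', NSub (var ''k'') (lit 1)]))
                      (RCell ''H'' [NSub (var ''b'') (lit 1), var ''a'', var ''k''])))
              take_edge)
         Skip)"

definition sample_path :: com where
  "sample_path =
     Seq (NAssign ''a'' [] (lit 0))
     (Seq (NAssign ''k'' [] in_m)
     (Seq (For ''i'' in_M sample_step)
          (NAssign ''length'' [] (NSub in_m (var ''k'')))))"

definition prepare :: com where
  "prepare =
     Seq find_context (Seq (averages (RCurrent (var ''j'')))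
       (Seq compute_edge_weights (Seq total_init total_step)))"

text \<open>Gains are accumulated for inadmissible edges too; these are filtered out when the
  weights are formed. No loop runs up to K.\<close>

definition update :: com where
  "update =
     For ''i'' in_n
       (Seq (averages (RContext (var ''i'') (var ''j'')))
         (For ''b'' (NAdd in_M (lit 1)) (For ''a'' (NAdd in_M (lit 1)) (For ''j'' in_M
           (Cond (BAnd (NLe (var ''a'') (var ''j''))
                 (BAnd (NLe (NAdd (var ''j'') (lit 1)) (var ''b''))
                 (BAnd (NLe (NAdd (var ''j'') (lit 1)) in_K)
                       (RLe (RCompeting (NSub in_K (NAdd (var ''j'') (lit 1))))
                            (RCell ''w'' [var ''b''])))))
             (RAssign ''S'' [var ''i'', var ''a'', var ''b'']
               (RAdd (RCell ''S'' [var ''i'', var ''a'', var ''b''])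
                     (RContext (var ''i'') (var ''j''))))
             Skip)))))"

definition hedge_algorithm :: algorithm where
  "hedge_algorithm = \<lparr>bid_prog = Seq prepare sample_path, update_prog = update\<rparr>"

lemmas com_defs = find_context_def averages_def compute_edge_weights_def total_init_def total_step_def
  take_edge_def sample_step_def sample_path_def prepare_def update_def

section \<open>Correctness of the programs\<close>

lemma sum_list_take_eq:
  assumes "length v = n"
  shows "sum_list (take b v) = (\<Sum>j<n. if Suc j \<le> b then v ! j else (0::real))"
proof -
  have "sum_list (take b v) = (\<Sum>j<min n b. v ! j)"
    using assms by (simp add: sum_list_sum_nth atLeast0LessThan)
  also have "\<dots> = (\<Sum>j\<in>{j\<in>{..<n}. Suc j \<le> b}. v ! j)"
    by (intro sum.cong) auto
  also have "\<dots> = (\<Sum>j<n. if Suc j \<le> b then v ! j else 0)"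
    by (rule sum.inter_filter) simp
  finally show ?thesis .
qed

text \<open>As the contexts are distinct, the flag survives the comparison only at i0, so later
  iterations leave \<open>c\<close> alone.\<close>

lemma wp_find_context:
  assumes "in_current I = vs ! i0" "i0 < length vs" "distinct vs" "vs = contexts (in_problem I)"
    and "\<forall>v\<in>set vs. length v = demand (in_problem I)"
  shows "wp I find_context (\<lambda>\<rho>. nmem \<rho> (''c'', []) = i0) \<sigma>"
  unfolding find_context_def
proof (rule wp_For[where Inv = "\<lambda>i \<rho>. i0 < i \<longrightarrow> nmem \<rho> (''c'', []) = i0"], goal_cases)
  case (2 i \<rho>)
  then have i: "i < length vs" using assms by simp
  define D where "D = demand (in_problem I)"
  have len: "length (vs ! i) = D" "length (vs ! i0) = D"
    using assms i by (auto simp: D_def)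
  have eq: "vs ! i = vs ! i0 \<longleftrightarrow> i = i0" using assms i by (auto simp: nth_eq_iff_index_eq)
  show ?case
    unfolding wp_simps
  proof (rule wp_For[where Inv = "\<lambda>j \<rho>. nmem \<rho> (''i'', []) = i \<and> (i0 < i \<longrightarrow> nmem \<rho> (''c'', []) = i0) \<and>
           (1 \<le> nmem \<rho> (''f'', []) \<longleftrightarrow> (\<forall>l<j. vs ! i ! l = vs ! i0 ! l))"], goal_cases)
    case (2 j \<rho>)
    then show ?case
      using len assms i by (auto simp: entry_def less_Suc_eq Let_def D_def)
  next
    case (3 \<rho>)
    then show ?case
      using len eq by (auto simp: list_eq_iff_nth_eq D_def[symmetric] less_Suc_eq)
  qed (use 2 in auto)
qed (use assms in auto)

text \<open>The hypothesis on e ranges over all configurations with the given \<open>i\<close>,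
  because e is evaluated inside loops that change \<open>j\<close>, \<open>b\<close> and
  \<open>w\<close>.\<close>

lemma wp_averages:
  assumes "demand (in_problem I) = M" "length v = M"
    and e: "\<And>\<rho>. nmem \<rho> (''i'', []) = i \<Longrightarrow> reval I \<rho> e = entry v (nmem \<rho> (''j'', []))"
    and i: "nmem \<sigma> (''i'', []) = i"
  shows "wp I (averages e) (\<lambda>\<rho>. \<forall>b\<le>M. rmem \<rho> (''w'', [b]) = avg_value v b) \<sigma>"
  unfolding averages_def
proof (rule wp_For[where Inv = "\<lambda>b \<rho>. nmem \<rho> (''i'', []) = i \<and>
         (\<forall>b'<b. rmem \<rho> (''w'', [b']) = avg_value v b')"], goal_cases)
  case (2 b \<rho>)
  show ?case
    unfolding wp_simps
  proof (rule wp_For[where Inv = "\<lambda>j \<rho>. nmem \<rho> (''i'', []) = i \<and> nmem \<rho> (''b'', []) = b \<and>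
         (\<forall>b'<b. rmem \<rho> (''w'', [b']) = avg_value v b') \<and>
         rmem \<rho> (''w'', [b]) = (\<Sum>l<j. if Suc l \<le> b then v ! l else 0)"], goal_cases)
    case (2 j \<rho>)
    then have "j < length v" using assms(1,2) by simp
    with 2 show ?case by (auto simp: e entry_def)
  next
    case (3 \<rho>)
    then have "rmem \<rho> (''w'', [b]) = sum_list (take b v)"
      using assms(1,2) sum_list_take_eq[of v M b] by simp
    with 3 show ?case by (auto simp: avg_value_def less_Suc_eq)
  qed (use 2 in auto)
qed (use assms(1) i in auto)

lemma wp_edge_weights:
  assumes "in_problem I = P" "demand P = M" "nmem \<sigma> (''c'', []) = i0"
    and "\<forall>b\<le>M. rmem \<sigma> (''w'', [b]) = avg_value v b"
  shows "wp I compute_edge_weights (\<lambda>\<rho>. \<forall>a\<le>M. \<forall>b\<le>M. rmem \<rho> (''E'', [a, b]) =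
           (if edge_ok v a b then exp (learning_rate P * rmem \<sigma> (''S'', [i0, a, b])) else 0)) \<sigma>"
proof -
  define g where "g a b =
     (if edge_ok v a b then exp (learning_rate P * rmem \<sigma> (''S'', [i0, a, b])) else 0)" for a b
  define J where "J \<rho> \<longleftrightarrow> nmem \<rho> (''c'', []) = i0 \<and>
      (\<forall>b\<le>M. rmem \<rho> (''w'', [b]) = avg_value v b) \<and> (\<forall>js. rmem \<rho> (''S'', js) = rmem \<sigma> (''S'', js))"
    for \<rho> :: config
  show ?thesis
    unfolding compute_edge_weights_def g_def[symmetric]
  proof (rule wp_For[where Inv = "\<lambda>a \<rho>. J \<rho> \<and> (\<forall>a'<a. \<forall>b\<le>M. rmem \<rho> (''E'', [a', b]) = g a' b)"], goal_cases)
    case (2 a \<rho>)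
    show ?case
    proof (rule wp_For[where Inv = "\<lambda>b \<rho>. J \<rho> \<and> nmem \<rho> (''a'', []) = a \<and>
        (\<forall>a'<a. \<forall>b\<le>M. rmem \<rho> (''E'', [a', b]) = g a' b) \<and>
        (\<forall>b'<b. rmem \<rho> (''E'', [a, b']) = g a b')"], goal_cases)
      case (2 b \<rho>)
      have "a \<le> M" "b \<le> M" using \<open>a < _\<close> 2 assms by auto
      then show ?case using 2 assms
        by (auto simp: J_def g_def edge_ok_def learning_rate_def less_Suc_eq)
    next
      case (3 \<rho>)
      then have "\<forall>b\<le>M. rmem \<rho> (''E'', [a, b]) = g a b"
        using assms(1,2) by (auto simp: less_Suc_eq_le)
      with 3 show ?case by (auto simp: less_Suc_eq)
    qed (use 2 in \<open>auto simp: J_def\<close>)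
  next
    case (3 \<rho>)
    then show ?case using assms by (auto simp: less_Suc_eq_le)
  qed (use assms in \<open>auto simp: J_def\<close>)
qed

lemma wp_total_init:
  assumes "in_problem I = P" "demand P = M" "strat_bound P = m"
  shows "wp I total_init (\<lambda>\<rho>. \<forall>a\<le>M. \<forall>k\<le>m. rmem \<rho> (''H'', [M, a, k]) = path_total M E 0 a k) \<sigma>"
  unfolding total_init_def
proof (rule wp_For[where Inv = "\<lambda>a \<rho>. \<forall>a'<a. \<forall>k\<le>m. rmem \<rho> (''H'', [M, a', k]) = path_total M E 0 a' k"],
    goal_cases)
  case (2 a \<rho>)
  show ?case
  proof (rule wp_For[where Inv = "\<lambda>k \<rho>. nmem \<rho> (''a'', []) = a \<and>
        (\<forall>a'<a. \<forall>k\<le>m. rmem \<rho> (''H'', [M, a', k]) = path_total M E 0 a' k) \<and>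
        (\<forall>k'<k. rmem \<rho> (''H'', [M, a, k']) = path_total M E 0 a k')"], goal_cases)
    case (3 \<rho>)
    then have "\<forall>k\<le>m. rmem \<rho> (''H'', [M, a, k]) = path_total M E 0 a k"
      using assms by (simp add: less_Suc_eq_le)
    with 3 show ?case by (auto simp: less_Suc_eq simp del: path_total.simps)
  qed (use 2 assms in \<open>auto simp: less_Suc_eq\<close>)
qed (use assms in \<open>auto simp: less_Suc_eq_le\<close>)

lemma wp_total_step:
  assumes "in_problem I = P" "demand P = M" "strat_bound P = m"
    and "\<forall>a\<le>M. \<forall>b\<le>M. rmem \<sigma> (''E'', [a, b]) = E a b"
    and "\<forall>a\<le>M. \<forall>k\<le>m. rmem \<sigma> (''H'', [M, a, k]) = path_total M E 0 a k"
  shows "wp I total_step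
    (\<lambda>\<rho>. \<forall>r\<le>M. \<forall>a\<le>M. \<forall>k\<le>m. rmem \<rho> (''H'', [M - r, a, k]) = path_total M E r a k) \<sigma>"
proof -
  define J where "J i \<rho> \<longleftrightarrow> (\<forall>a\<le>M. \<forall>b\<le>M. rmem \<rho> (''E'', [a, b]) = E a b) \<and>
      (\<forall>r\<le>i. \<forall>a\<le>M. \<forall>k\<le>m. rmem \<rho> (''H'', [M - r, a, k]) = path_total M E r a k)"
    for i and \<rho> :: config
  show ?thesis
    unfolding total_step_def
  proof (rule wp_For[where Inv = J], goal_cases)
    case (2 i \<rho>)
    then have i: "i < M" using assms by simp
    show ?case
      unfolding wp_simps
    proof (rule wp_For[where Inv = "\<lambda>a \<rho>. J i \<rho> \<and> nmem \<rho> (''b'', []) = M - i \<and>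
        (\<forall>a'<a. \<forall>k\<le>m. rmem \<rho> (''H'', [M - Suc i, a', k]) = path_total M E (Suc i) a' k)"], goal_cases)
      case (2 a \<rho>)
      then have a: "a \<le> M" using assms by simp
      define R where "R k \<rho> \<longleftrightarrow> J i \<rho> \<and> nmem \<rho> (''b'', []) = M - i \<and> nmem \<rho> (''a'', []) = a \<and>
        (\<forall>a'<a. \<forall>k\<le>m. rmem \<rho> (''H'', [M - Suc i, a', k]) = path_total M E (Suc i) a' k) \<and>
        (\<forall>k'<k. rmem \<rho> (''H'', [M - Suc i, a, k']) = path_total M E (Suc i) a k')"
        for k and \<rho> :: config
      show ?case
      proof (rule wp_For[where Inv = R], goal_cases)
        case (2 k \<rho>)
        then have k: "k \<le> m" using assms by simp
        have J: "J i \<rho>" and b: "nmem \<rho> (''b'', []) = M - i" and aa: "nmem \<rho> (''a'', []) = a"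
          using 2 by (simp_all add: R_def)
        then have *: "rmem \<rho> (''H'', [M - i, a, k]) = path_total M E i a k"
            "rmem \<rho> (''H'', [M - i, M - i, k - Suc 0]) = path_total M E i (M - i) (k - Suc 0)"
            "rmem \<rho> (''E'', [a, M - i]) = E a (M - i)"
          using a k by (simp_all add: J_def)
        have step: "R (Suc k) \<rho>'"
          if \<rho>': "rmem \<rho>' = (rmem \<rho>)((''H'', [M - Suc i, a, k]) := path_total M E (Suc i) a k)"
            "nmem \<rho>' = (nmem \<rho>)((''k'', []) := k)" for \<rho>' :: config
          unfolding R_def
        proof (intro conjI)
          \<comment> \<open>With truncated subtraction this depends on i < M: the new layer must not
            overwrite one that is already computed.\<close>
          have "M - r \<noteq> M - Suc i" if "r \<le> i" for r using that i by simp
          then show "J i \<rho>'" using J \<rho>' by (simp add: J_def del: path_total.simps)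
        qed (use 2 \<rho>' in \<open>auto simp: R_def less_Suc_eq simp del: path_total.simps\<close>)
        show ?case
          using * b aa by (auto intro!: step)
      next
        case (3 \<rho>)
        then have "\<forall>k\<le>m. rmem \<rho> (''H'', [M - Suc i, a, k]) = path_total M E (Suc i) a k"
          using assms(1,3) by (simp add: R_def less_Suc_eq_le del: path_total.simps)
        with 3 show ?case by (auto simp: R_def less_Suc_eq simp del: path_total.simps)
      qed (use 2 in \<open>auto simp: J_def R_def simp del: path_total.simps\<close>)
    next
      case (3 \<rho>)
      then have "\<forall>a\<le>M. \<forall>k\<le>m. rmem \<rho> (''H'', [M - Suc i, a, k]) = path_total M E (Suc i) a k"
        using assms(1,2) by (simp add: less_Suc_eq_le del: path_total.simps)
      with 3 show ?case by (auto simp: J_def le_Suc_eq simp del: path_total.simps)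
    qed (use 2 assms(1,2) in \<open>auto simp: J_def simp del: path_total.simps\<close>)
  qed (use assms in \<open>auto simp: J_def simp del: path_total.simps(2)\<close>)
qed

lemma wp_update:
  assumes "in_problem I = P" "demand P = M" "contexts P = vs" "units P = K" "in_competing I = \<beta>"
    and len: "\<forall>v\<in>set vs. length v = M"
  shows "wp I update (\<lambda>\<rho>. \<forall>i<length vs. \<forall>a\<le>M. \<forall>b\<le>M. rmem \<rho> (''S'', [i, a, b]) =
           rmem \<sigma> (''S'', [i, a, b]) + edge_value K (vs ! i) \<beta> a b) \<sigma>"
proof -
  define gain where "gain i a b j =
     (if a \<le> j \<and> Suc j \<le> b \<and> Suc j \<le> K \<and> entry \<beta> (K - Suc j) \<le> avg_value (vs ! i) b
      then vs ! i ! j else 0)" for i a b j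
  define tot where "tot i a b = (\<Sum>j<M. gain i a b j)" for i a b
  \<comment> \<open>X marks the finished triples in the lexicographic order (i, b, a) of the loops;
    f holds the partial sums of the others, nonzero only for the triple being processed.\<close>
  define J where "J X f \<rho> \<longleftrightarrow> (\<forall>i a b. a \<le> M \<longrightarrow> b \<le> M \<longrightarrow> rmem \<rho> (''S'', [i, a, b]) =
    rmem \<sigma> (''S'', [i, a, b]) + (if X i b a then tot i a b else f i b a))"
    for X f and \<rho> :: config
  \<comment> \<open>Passing between the invariants of nested loops changes the bookkeeping X and f
    but not the contents they prescribe for \<open>S\<close>.\<close>
  have J_cong: "J X f \<rho>"
    if "J X' f' \<rho>'" "\<forall>js. rmem \<rho> (''S'', js) = rmem \<rho>' (''S'', js)"
      "\<And>i b a. a \<le> M \<Longrightarrow> b \<le> M \<Longrightarrow>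
        (if X i b a then tot i a b else f i b a) = (if X' i b a then tot i a b else f' i b a)"
    for X f X' f' and \<rho> \<rho>' :: config
    using that by (simp add: J_def)
  let ?z = "\<lambda>_ _ _. 0 :: real"
  define W where "W i \<rho> \<longleftrightarrow> nmem \<rho> (''i'', []) = i \<and> (\<forall>b\<le>M. rmem \<rho> (''w'', [b]) = avg_value (vs ! i) b)"
    for i and \<rho> :: config
  define R where "R i b a j \<rho> \<longleftrightarrow> J (\<lambda>i' b' a'. i' < i \<or> i' = i \<and> (b' < b \<or> b' = b \<and> a' < a))
      (\<lambda>i' b' a'. if i' = i \<and> b' = b \<and> a' = a then \<Sum>j'<j. gain i a b j' else 0) \<rho> \<and>
      W i \<rho> \<and> nmem \<rho> (''b'', []) = b \<and> nmem \<rho> (''a'', []) = a" for i b a j and \<rho> :: config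
  have R_step: "R i b a (Suc j) \<rho>'"
    if "R i b a j \<rho>" "rmem \<rho>' = (rmem \<rho>)((''S'', [i, a, b]) := rmem \<rho> (''S'', [i, a, b]) + gain i a b j)"
       "nmem \<rho>' = (nmem \<rho>)((''j'', []) := j)" for i b a j and \<rho> \<rho>' :: config
    using that by (auto simp: R_def J_def W_def)
  have R_skip: "R i b a (Suc j) \<rho>'"
    if "R i b a j \<rho>" "rmem \<rho>' = rmem \<rho>" "gain i a b j = 0"
       "nmem \<rho>' = (nmem \<rho>)((''j'', []) := j)" for i b a j and \<rho> \<rho>' :: config
    using that by (auto simp: R_def J_def W_def)
  show ?thesis
    unfolding update_def
  proof (rule wp_For[where Inv = "\<lambda>i. J (\<lambda>i' _ _. i' < i) ?z"], goal_cases)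
    case (2 i \<rho>)
    then have i: "i < length vs" using assms by simp
    have avg: "wp I (averages (RContext (var ''i'') (var ''j'')))
        (\<lambda>\<rho>. \<forall>b\<le>M. rmem \<rho> (''w'', [b]) = avg_value (vs ! i) b) (nwrite (''i'', []) i (tick \<rho>))"
      using assms i by (intro wp_averages) auto
    have "wp I (averages (RContext (var ''i'') (var ''j'')))
        (\<lambda>\<rho>. J (\<lambda>i' _ _. i' < i) ?z \<rho> \<and> W i \<rho>) (nwrite (''i'', []) i (tick \<rho>))"
      by (rule wp_with_frame[OF avg])
        (use 2 in \<open>auto simp: agree_off_def averages_def J_def W_def\<close>)
    then show ?case
      unfolding wp_simps
    proof (rule wp_mono, goal_cases)
      case (1 \<rho>)
      show ?case
      proof (rule wp_For[where Inv = "\<lambda>b \<rho>. J (\<lambda>i' b' _. i' < i \<or> i' = i \<and> b' < b) ?z \<rho> \<and> W i \<rho>"], goal_cases)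
        case (2 b \<rho>)
        then have b: "b \<le> M" using assms by simp
        show ?case
        proof (rule wp_For[where Inv = "\<lambda>a \<rho>. J (\<lambda>i' b' a'. i' < i \<or> i' = i \<and> (b' < b \<or> b' = b \<and> a' < a)) ?z \<rho> \<and>
              W i \<rho> \<and> nmem \<rho> (''b'', []) = b"], goal_cases)
          case 1
          show ?case using 2 by (auto elim!: J_cong simp: W_def)
        next
          case (2 a \<rho>)
          then have a: "a \<le> M" using assms by simp
          show ?case
          proof (rule wp_For[where Inv = "R i b a"], goal_cases)
            case 1
            show ?case using 2 by (auto elim!: J_cong simp: W_def R_def)
          next
            case (2 j \<rho>)
            have j: "j < M" "length (vs ! i) = M" using 2 assms(1,2) len i by auto
            have mem: "nmem \<rho> (''i'', []) = i" "nmem \<rho> (''b'', []) = b" "nmem \<rho> (''a'', []) = a"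
              "rmem \<rho> (''w'', [b]) = avg_value (vs ! i) b"
              using 2 b by (auto simp: R_def W_def)
            have e: "entry (vs ! i) j = vs ! i ! j" using j by (simp add: entry_def)
            show ?case
            proof (cases "a \<le> j \<and> Suc j \<le> b \<and> Suc j \<le> K \<and> entry \<beta> (K - Suc j) \<le> avg_value (vs ! i) b")
              case True
              then have "R i b a (Suc j) (rwrite (''S'', [i, a, b]) (rmem \<rho> (''S'', [i, a, b]) + vs ! i ! j)
                  (tick (tick (nwrite (''j'', []) j (tick \<rho>)))))"
                using 2 by (intro R_step[of i b a j \<rho>]) (simp_all add: gain_def)
              then show ?thesis using True assms(1-5) i e mem by (simp add: Let_def)
            next
              case False
              then have "gain i a b j = 0" by (auto simp: gain_def)
              then have "R i b a (Suc j) (tick (nwrite (''j'', []) j (tick \<rho>)))"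
                using 2 by (intro R_skip[of i b a j \<rho>]) simp_all
              then show ?thesis using False assms(1-5) mem by (subst wp_simps(5)) (subst if_not_P, auto)
            qed
          next
            case (3 \<rho>)
            then have "R i b a M \<rho>" using assms by simp
            then show ?case by (auto elim!: J_cong simp: R_def tot_def)
          qed
        next
          case (3 \<rho>)
          then show ?case using assms(1,2) by (auto elim!: J_cong)
        qed
      next
        case (3 \<rho>)
        then show ?case using assms(1,2) by (auto elim!: J_cong)
      qed (use 1 in \<open>auto elim!: J_cong simp: W_def\<close>)
    qed
  next
    case (3 \<rho>)
    have "tot i a b = edge_value K (vs ! i) \<beta> a b" if "i < length vs" for i a b
      unfolding tot_def edge_value_def by (rule sum.cong) (use len that in \<open>simp_all add: gain_def\<close>)
    with 3 show ?case using assms(1-3) by (simp add: J_def)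
  qed (auto simp: J_def)
qed

section \<open>The sampling loop as a distribution on paths\<close>

lemma iterate_pmf_front:
  "iterate_pmf f (Suc n) x = bind_pmf (f 0 x) (iterate_pmf (\<lambda>i. f (Suc i)) n)"
proof (induction n)
  case (Suc n)
  have "iterate_pmf f (Suc (Suc n)) x = bind_pmf (bind_pmf (f 0 x) (iterate_pmf (\<lambda>i. f (Suc i)) n)) (f (Suc n))"
    using Suc by simp
  then show ?case by (simp add: bind_assoc_pmf)
qed (simp add: bind_return_pmf bind_return_pmf')

text \<open>Node M - r is taken with the fraction of the remaining total weight that passes through
  it. If that total is 0, division by zero gives probability 0 and the node is skipped.\<close>

primrec sample :: "nat \<Rightarrow> (nat \<Rightarrow> nat \<Rightarrow> real) \<Rightarrow> nat \<Rightarrow> nat \<Rightarrow> nat \<Rightarrow> nat list pmf" where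
  "sample M E 0 = (\<lambda>a k. return_pmf [])"
| "sample M E (Suc r) = (\<lambda>a k. if 0 < k
     then bind_pmf (bernoulli_pmf (E a (M - r) * path_total M E r (M - r) (k - 1) / path_total M E (Suc r) a k))
            (\<lambda>z. if z then map_pmf ((#) (M - r)) (sample M E r (M - r) (k - 1)) else sample M E r a k)
     else sample M E r a k)"

primrec path_strategy :: "(nat \<Rightarrow> real) \<Rightarrow> nat \<Rightarrow> nat list \<Rightarrow> strategy" where
  "path_strategy w a [] = []"
| "path_strategy w a (b # bs) = (w b, b - a) # path_strategy w b bs"

text \<open>Agrees with \<open>submitted\<close> once the length m - k has been stored, but can
  already be read during the loop.\<close>

definition output_so_far :: "nat \<Rightarrow> config \<Rightarrow> strategy" where
  "output_so_far m \<sigma> = map (\<lambda>l. (rmem \<sigma> (''bid'', [l]), nmem \<sigma> (''quantity'', [l]))) [0..<m - nmem \<sigma> (''k'', [])]"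

text \<open>An equation of distributions rather than a \<open>wp\<close> statement, because the
  probabilities matter here.\<close>

lemma exec_sample_step:
  assumes "in_problem I = P" "demand P = M" "strat_bound P = m" "r < M"
    and "nmem \<sigma> (''i'', []) = M - Suc r" "nmem \<sigma> (''a'', []) = a" "nmem \<sigma> (''k'', []) = k"
  shows "exec I sample_step \<sigma> =
    (if 0 < k
     then map_pmf (\<lambda>z.
            let \<rho> = tick (nwrite (''x'', []) (of_bool z) (tick (tick (nwrite (''b'', []) (M - r) (tick \<sigma>)))))
            in if z then nwrite (''k'', []) (k - 1) (tick (nwrite (''a'', []) (M - r) (tick
                 (nwrite (''quantity'', [m - k]) (M - r - a) (tick
                 (rwrite (''bid'', [m - k]) (rmem \<sigma> (''w'', [M - r])) (tick \<rho>)))))))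
               else \<rho>)
          (bernoulli_pmf (rmem \<sigma> (''E'', [a, M - r]) * rmem \<sigma> (''H'', [M - r, M - r, k - 1])
                          / rmem \<sigma> (''H'', [M - Suc r, a, k])))
     else return_pmf (tick (nwrite (''b'', []) (M - r) (tick \<sigma>))))"
proof -
  \<comment> \<open>In iteration i = M - (r+1) the addition-free expression for node i + 1 evaluates
    to M - r.\<close>
  have "M - (M - Suc (M - Suc r)) = M - r" "M - Suc (M - Suc r) = r" "M - r - Suc 0 = M - Suc r" using assms by auto
  note simps = this
  show ?thesis
  proof (cases "k = 0")
    case True
    with assms simps show ?thesis by (simp add: sample_step_def bind_return_pmf)
  next
    case False
    let ?\<rho> = "\<lambda>z. nwrite (''x'', []) (of_bool z) (tick (tick (nwrite (''b'', []) (M - r) (tick \<sigma>))))"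
    have "exec I take_edge (?\<rho> z) = return_pmf (let \<rho> = tick (?\<rho> z)
            in if z then nwrite (''k'', []) (k - 1) (tick (nwrite (''a'', []) (M - r) (tick
                 (nwrite (''quantity'', [m - k]) (M - r - a) (tick
                 (rwrite (''bid'', [m - k]) (rmem \<sigma> (''w'', [M - r])) (tick \<rho>)))))))
               else \<rho>)" for z
      using assms by (simp add: take_edge_def bind_return_pmf)
    with False assms simps show ?thesis
      by (simp add: sample_step_def bind_return_pmf bind_assoc_pmf map_pmf_def)
  qed
qed

definition ready :: "nat \<Rightarrow> nat \<Rightarrow> (nat \<Rightarrow> nat \<Rightarrow> real) \<Rightarrow> (nat \<Rightarrow> real) \<Rightarrow> config \<Rightarrow> bool" where
  "ready M m E w \<sigma> \<longleftrightarrow>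
     (\<forall>b\<le>M. rmem \<sigma> (''w'', [b]) = w b) \<and>
     (\<forall>a\<le>M. \<forall>b\<le>M. rmem \<sigma> (''E'', [a, b]) = E a b) \<and>
     (\<forall>r\<le>M. \<forall>a\<le>M. \<forall>k\<le>m. rmem \<sigma> (''H'', [M - r, a, k]) = path_total M E r a k)"

text \<open>Only images under \<open>output_so_far\<close> are compared, since the scratch cells
  retain traces of the run. For the induction on the remaining nodes, the last node, the edge budget
  and the output already produced are arbitrary.\<close>

lemma sample_loop:
  assumes P: "in_problem I = P" "demand P = M" "strat_bound P = m"
    and "ready M m E w \<sigma>" "nmem \<sigma> (''a'', []) \<le> M" "nmem \<sigma> (''k'', []) \<le> m" "r \<le> M"
  shows "map_pmf (output_so_far m) (iterate_pmf (\<lambda>i \<rho>. exec I sample_step (nwrite (''i'', []) (M - r + i) (tick \<rho>))) r \<sigma>) =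
    map_pmf (\<lambda>bs. output_so_far m \<sigma> @ path_strategy w (nmem \<sigma> (''a'', [])) bs)
      (sample M E r (nmem \<sigma> (''a'', [])) (nmem \<sigma> (''k'', [])))"
  using assms(4-7)
proof (induction r arbitrary: \<sigma>)
  case 0
  then show ?case by simp
next
  case (Suc r)
  let ?f = "\<lambda>i \<rho>. exec I sample_step (nwrite (''i'', []) (M - Suc r + i) (tick \<rho>))"
  define a where "a = nmem \<sigma> (''a'', [])"
  define k where "k = nmem \<sigma> (''k'', [])"
  define \<sigma>' where "\<sigma>' = nwrite (''i'', []) (M - Suc r) (tick \<sigma>)"
  have \<sigma>': "nmem \<sigma>' = (nmem \<sigma>)((''i'', []) := M - Suc r)" "rmem \<sigma>' = rmem \<sigma>"
    by (simp_all add: \<sigma>'_def)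
  have bounds: "a \<le> M" "k \<le> m" "r < M" using Suc.prems by (auto simp: a_def k_def)
  have shift: "(\<lambda>i. ?f (Suc i)) = (\<lambda>i \<rho>. exec I sample_step (nwrite (''i'', []) (M - r + i) (tick \<rho>)))"
    using bounds by (simp add: fun_eq_iff Suc_diff_Suc flip: add_Suc_right)
  define rest where "rest = iterate_pmf (\<lambda>i \<rho>. exec I sample_step (nwrite (''i'', []) (M - r + i) (tick \<rho>))) r"
  have IH: "map_pmf (output_so_far m) (rest \<rho>) =
      map_pmf (\<lambda>bs. output_so_far m \<rho> @ path_strategy w (nmem \<rho> (''a'', [])) bs)
        (sample M E r (nmem \<rho> (''a'', [])) (nmem \<rho> (''k'', [])))"
    if "ready M m E w \<rho>" "nmem \<rho> (''a'', []) \<le> M" "nmem \<rho> (''k'', []) \<le> m" for \<rho>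
    unfolding rest_def using that bounds by (intro Suc.IH) auto
  \<comment> \<open>The semantics of a loop appends iterations at the end, whereas
    \<open>sample\<close> splits off the first node.\<close>
  have unfold: "iterate_pmf ?f (Suc r) \<sigma> = bind_pmf (exec I sample_step \<sigma>') rest"
    unfolding iterate_pmf_front shift rest_def \<sigma>'_def by simp
  have vals: "rmem \<sigma>' (''w'', [M - r]) = w (M - r)"
      "rmem \<sigma>' (''E'', [a, M - r]) = E a (M - r)"
      "rmem \<sigma>' (''H'', [M - r, M - r, k - 1]) = path_total M E r (M - r) (k - 1)"
      "rmem \<sigma>' (''H'', [M - Suc r, a, k]) = path_total M E (Suc r) a k"
    using Suc.prems(1) bounds by (simp_all add: ready_def \<sigma>' del: path_total.simps)
  have step: "exec I sample_step \<sigma>' =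
    (if 0 < k
     then map_pmf (\<lambda>z.
            let \<rho> = tick (nwrite (''x'', []) (of_bool z) (tick (tick (nwrite (''b'', []) (M - r) (tick \<sigma>')))))
            in if z then nwrite (''k'', []) (k - 1) (tick (nwrite (''a'', []) (M - r) (tick
                 (nwrite (''quantity'', [m - k]) (M - r - a) (tick
                 (rwrite (''bid'', [m - k]) (w (M - r)) (tick \<rho>)))))))
               else \<rho>)
          (bernoulli_pmf (E a (M - r) * path_total M E r (M - r) (k - 1) / path_total M E (Suc r) a k))
     else return_pmf (tick (nwrite (''b'', []) (M - r) (tick \<sigma>'))))"
    unfolding vals[symmetric]
    by (rule exec_sample_step[OF P \<open>r < M\<close>]) (simp_all add: \<sigma>' a_def k_def)
  \<comment> \<open>Node M - r is skipped: only scratch cells change, so the last node, the budget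
    and the output persist.\<close>
  have keep: "map_pmf (output_so_far m) (rest \<rho>) =
      map_pmf (\<lambda>bs. output_so_far m \<sigma> @ path_strategy w a bs) (sample M E r a k)"
    if "rmem \<rho> = rmem \<sigma>" "\<And>x js. x \<notin> {''x'', ''b'', ''i''} \<Longrightarrow> nmem \<rho> (x, js) = nmem \<sigma> (x, js)" for \<rho>
  proof -
    have "ready M m E w \<rho>" using Suc.prems(1) that by (simp add: ready_def)
    moreover have "output_so_far m \<rho> = output_so_far m \<sigma>" using that by (simp add: output_so_far_def)
    ultimately show ?thesis
      using IH[of \<rho>] that Suc.prems by (simp add: a_def k_def)
  qed
  show ?case
  proof (cases "k = 0")
    case True
    have "map_pmf (output_so_far m) (rest (tick (nwrite (''b'', []) (M - r) (tick \<sigma>')))) =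
        map_pmf (\<lambda>bs. output_so_far m \<sigma> @ path_strategy w a bs) (sample M E r a k)"
      by (rule keep) (auto simp: \<sigma>')
    with True show ?thesis
      unfolding unfold step by (simp add: bind_return_pmf flip: a_def k_def)
  next
    case False
    \<comment> \<open>Node M - r is taken: exactly one pair is appended, at position m - k, and the
      rest of the loop continues from the new node.\<close>
    have go: "map_pmf (output_so_far m) (rest \<rho>) =
      map_pmf (\<lambda>bs. output_so_far m \<sigma> @ path_strategy w a bs) (map_pmf ((#) (M - r)) (sample M E r (M - r) (k - 1)))"
      if "rmem \<rho> = (rmem \<sigma>)((''bid'', [m - k]) := w (M - r))"
        "\<And>x js. x \<notin> {''x'', ''b'', ''i'', ''a'', ''k'', ''quantity''} \<Longrightarrow> nmem \<rho> (x, js) = nmem \<sigma> (x, js)"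
        "nmem \<rho> (''a'', []) = M - r" "nmem \<rho> (''k'', []) = k - 1"
        "\<And>l. nmem \<rho> (''quantity'', [l]) = (if l = m - k then M - r - a else nmem \<sigma> (''quantity'', [l]))" for \<rho>
    proof -
      have "ready M m E w \<rho>" using Suc.prems(1) that by (simp add: ready_def)
      moreover have "m - (k - 1) = Suc (m - k)" using False bounds by simp
      then have "output_so_far m \<rho> = output_so_far m \<sigma> @ [(w (M - r), M - r - a)]"
        using that by (simp add: output_so_far_def flip: k_def)
      ultimately show ?thesis
        using IH[of \<rho>] that bounds by (simp add: map_pmf_comp)
    qed
    define next_config where "next_config z =
        (let \<rho> = tick (nwrite (''x'', []) (of_bool z) (tick (tick (nwrite (''b'', []) (M - r) (tick \<sigma>')))))
         in if z then nwrite (''k'', []) (k - 1) (tick (nwrite (''a'', []) (M - r) (tick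
              (nwrite (''quantity'', [m - k]) (M - r - a) (tick
              (rwrite (''bid'', [m - k]) (w (M - r)) (tick \<rho>)))))))
            else \<rho>)" for z
    have "map_pmf (output_so_far m) (rest (next_config True)) =
      map_pmf (\<lambda>bs. output_so_far m \<sigma> @ path_strategy w a bs) (map_pmf ((#) (M - r)) (sample M E r (M - r) (k - 1)))"
      by (rule go) (auto simp: next_config_def \<sigma>' Let_def)
    moreover have "map_pmf (output_so_far m) (rest (next_config False)) =
      map_pmf (\<lambda>bs. output_so_far m \<sigma> @ path_strategy w a bs) (sample M E r a k)"
      by (rule keep) (auto simp: next_config_def \<sigma>' Let_def)
    ultimately have "map_pmf (output_so_far m) (rest (next_config z)) =
      map_pmf (\<lambda>bs. output_so_far m \<sigma> @ path_strategy w a bs)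
        (if z then map_pmf ((#) (M - r)) (sample M E r (M - r) (k - 1)) else sample M E r a k)" for z
      by (cases z) (simp_all only: if_True if_False)
    then show ?thesis
      unfolding unfold step next_config_def[symmetric] a_def[symmetric] k_def[symmetric]
      using False by (simp add: bind_map_pmf map_bind_pmf del: path_total.simps)
  qed
qed

lemma map_sample_path:
  assumes P: "in_problem I = P" "demand P = M" "strat_bound P = m" and \<sigma>: "ready M m E w \<sigma>"
  shows "map_pmf submitted (exec I sample_path \<sigma>) = map_pmf (path_strategy w 0) (sample M E M 0 m)"
proof -
  define \<sigma>' where "\<sigma>' = nwrite (''k'', []) m (tick (nwrite (''a'', []) 0 (tick \<sigma>)))"
  have "exec I sample_path \<sigma> = map_pmf (\<lambda>\<rho>. nwrite (''length'', []) (m - nmem \<rho> (''k'', [])) (tick \<rho>))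
      (iterate_pmf (\<lambda>i \<rho>. exec I sample_step (nwrite (''i'', []) (M - M + i) (tick \<rho>))) M (tick \<sigma>'))"
    using P by (simp add: sample_path_def bind_return_pmf map_pmf_def \<sigma>'_def)
  then have "map_pmf submitted (exec I sample_path \<sigma>) = map_pmf (output_so_far m)
      (iterate_pmf (\<lambda>i \<rho>. exec I sample_step (nwrite (''i'', []) (M - M + i) (tick \<rho>))) M (tick \<sigma>'))"
    by (simp add: map_pmf_comp submitted_def output_so_far_def[abs_def])
  also have "\<dots> = map_pmf (\<lambda>bs. output_so_far m (tick \<sigma>') @ path_strategy w (nmem (tick \<sigma>') (''a'', [])) bs)
      (sample M E M (nmem (tick \<sigma>') (''a'', [])) (nmem (tick \<sigma>') (''k'', [])))"
    by (rule sample_loop[OF P]) (use \<sigma> in \<open>simp_all add: ready_def \<sigma>'_def\<close>)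
  finally show ?thesis by (simp add: \<sigma>'_def output_so_far_def)
qed

definition edge_weight :: "problem \<Rightarrow> valuation \<Rightarrow> (nat \<Rightarrow> nat \<Rightarrow> real) \<Rightarrow> nat \<Rightarrow> nat \<Rightarrow> real" where
  "edge_weight P v S a b = (if edge_ok v a b then exp (learning_rate P * S a b) else 0)"

lemma wp_prepare:
  assumes P: "valid_problem P" "i < length (contexts P)" "v = contexts P ! i" "I = bid_input P v"
  shows "wp I prepare (ready (demand P) (strat_bound P)
      (edge_weight P v (\<lambda>a b. rmem \<sigma> (''S'', [i, a, b]))) (avg_value v)) \<sigma>"
proof -
  define M where "M = demand P"
  define m where "m = strat_bound P"
  define E where "E = edge_weight P v (\<lambda>a b. rmem \<sigma> (''S'', [i, a, b]))"
  have len: "\<forall>v\<in>set (contexts P). length v = M" and dist: "distinct (contexts P)"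
    using P by (auto simp: valid_problem_def valuations_def M_def)
  have I: "in_problem I = P" "in_current I = v" using P by (auto simp: bid_input_def)
  have v: "length v = M" using len P by auto
  let ?S = "\<lambda>\<rho> :: config. \<forall>js. rmem \<rho> (''S'', js) = rmem \<sigma> (''S'', js)"
  let ?W = "\<lambda>\<rho> :: config. \<forall>b\<le>M. rmem \<rho> (''w'', [b]) = avg_value v b"
  let ?E = "\<lambda>\<rho> :: config. \<forall>a\<le>M. \<forall>b\<le>M. rmem \<rho> (''E'', [a, b]) = E a b"
  have 1: "wp I find_context (\<lambda>\<rho>. nmem \<rho> (''c'', []) = i \<and> ?S \<rho>) \<sigma>"
    by (rule wp_with_frame, rule wp_find_context[of I "contexts P" i])
      (use I P len dist in \<open>auto simp: agree_off_def find_context_def M_def\<close>)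
  have 2: "wp I (averages (RCurrent (var ''j''))) (\<lambda>\<rho>. nmem \<rho> (''c'', []) = i \<and> ?S \<rho> \<and> ?W \<rho>) \<rho>"
    if "nmem \<rho> (''c'', []) = i \<and> ?S \<rho>" for \<rho>
    by (rule wp_with_frame, rule wp_averages[of I M v _ _ \<rho>])
      (use I v that in \<open>auto simp: agree_off_def averages_def M_def\<close>)
  have 3: "wp I compute_edge_weights (\<lambda>\<rho>. ?W \<rho> \<and> ?E \<rho>) \<rho>" if "nmem \<rho> (''c'', []) = i \<and> ?S \<rho> \<and> ?W \<rho>" for \<rho>
    by (rule wp_with_frame, rule wp_edge_weights[of I P M \<rho> i v])
      (use I that in \<open>auto simp: agree_off_def compute_edge_weights_def M_def E_def edge_weight_def\<close>)
  have 4: "wp I total_init (\<lambda>\<rho>. ?W \<rho> \<and> ?E \<rho> \<and>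
      (\<forall>a\<le>M. \<forall>k\<le>m. rmem \<rho> (''H'', [M, a, k]) = path_total M E 0 a k)) \<rho>" if "?W \<rho> \<and> ?E \<rho>" for \<rho>
    by (rule wp_with_frame, rule wp_total_init[of I P M m])
      (use I that in \<open>auto simp: agree_off_def total_init_def M_def m_def\<close>)
  have 5: "wp I total_step (ready M m E (avg_value v)) \<rho>"
    if "?W \<rho> \<and> ?E \<rho> \<and> (\<forall>a\<le>M. \<forall>k\<le>m. rmem \<rho> (''H'', [M, a, k]) = path_total M E 0 a k)" for \<rho>
    by (rule wp_with_frame, rule wp_total_step[of I P M m \<rho> E])
      (use I that in \<open>auto simp: agree_off_def total_step_def M_def m_def ready_def simp del: path_total.simps\<close>)
  show ?thesis
    unfolding prepare_def wp_simps M_def[symmetric] m_def[symmetric] E_def[symmetric]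
    by (rule wp_mono[OF 1], rule wp_mono[OF 2], assumption, rule wp_mono[OF 3], assumption,
        rule wp_mono[OF 4], assumption, rule 5)
qed

text \<open>Every outcome of \<open>prepare\<close> is \<open>ready\<close> with the same weights,
  so the law of the sampled strategy is constant on its support and the outer bind
  collapses.\<close>

lemma map_bid_prog:
  assumes "valid_problem P" "i < length (contexts P)" "v = contexts P ! i"
  shows "map_pmf submitted (exec (bid_input P v) (bid_prog hedge_algorithm) \<sigma>) =
    map_pmf (path_strategy (avg_value v) 0) (sample (demand P)
      (edge_weight P v (\<lambda>a b. rmem \<sigma> (''S'', [i, a, b]))) (demand P) 0 (strat_bound P))" (is "_ = ?D")
proof -
  let ?I = "bid_input P v"
  have "map_pmf submitted (exec ?I (bid_prog hedge_algorithm) \<sigma>) =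
      bind_pmf (exec ?I prepare \<sigma>) (\<lambda>\<rho>. map_pmf submitted (exec ?I sample_path \<rho>))"
    by (simp add: hedge_algorithm_def map_bind_pmf)
  also have "\<dots> = bind_pmf (exec ?I prepare \<sigma>) (\<lambda>_. ?D)"
    using wp_prepare[OF assms refl, of \<sigma>]
    by (intro bind_pmf_cong refl map_sample_path) (auto simp: wp_def bid_input_def)
  finally show ?thesis by simp
qed

section \<open>Paths\<close>

text \<open>The node a is not compared with the entries of the list; it only decides whether
  stopping at once is allowed. This keeps the recursion in r free of side conditions on a.\<close>

definition paths :: "nat \<Rightarrow> nat \<Rightarrow> nat \<Rightarrow> nat \<Rightarrow> nat list set" where
  "paths M r a k = {bs. sorted_wrt (<) bs \<and> set bs \<subseteq> {M - r<..M} \<and> length bs \<le> k \<and> (bs = [] \<longrightarrow> 0 < a)}"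

primrec path_weight :: "(nat \<Rightarrow> nat \<Rightarrow> real) \<Rightarrow> nat \<Rightarrow> nat list \<Rightarrow> real" where
  "path_weight E a [] = 1"
| "path_weight E a (b # bs) = E a b * path_weight E b bs"

lemma paths_0: "paths M 0 a k = (if 0 < a then {[]} else {})"
  by (auto simp: paths_def)

text \<open>Split by whether M - r is the first node. The assumption r < M makes M - r positive, so
  the tail after it may be empty.\<close>

lemma paths_Suc:
  assumes "r < M"
  shows "paths M (Suc r) a k = paths M r a k \<union> (if 0 < k then (#) (M - r) ` paths M r (M - r) (k - 1) else {})"
    (is "?L = ?R")
proof (intro equalityI subsetI)
  fix bs assume "bs \<in> ?L"
  show "bs \<in> ?R"
  proof (cases bs)
    case Nil
    with \<open>bs \<in> ?L\<close> show ?thesis by (auto simp: paths_def)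
  next
    case (Cons b cs)
    have b: "M - Suc r < b" "b \<le> M" and cs: "\<forall>c\<in>set cs. b < c" "sorted_wrt (<) cs" "set cs \<subseteq> {..M}" "Suc (length cs) \<le> k"
      using \<open>bs \<in> ?L\<close> by (auto simp: paths_def Cons)
    show ?thesis
    proof (cases "b = M - r")
      case True
      have "cs \<in> paths M r (M - r) (k - 1)"
        using cs assms by (auto simp: paths_def True)
      then show ?thesis using cs True by (auto simp: Cons)
    next
      case False
      with b have "M - r < b" by simp
      then have "bs \<in> paths M r a k" using cs b by (force simp: paths_def Cons)
      then show ?thesis by simp
    qed
  qed
next
  fix bs assume "bs \<in> ?R"
  then show "bs \<in> ?L" using assms by (fastforce simp: paths_def split: if_splits)
qed

lemma paths_disjoint: "paths M r a k \<inter> (#) (M - r) ` X = {}"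
  by (auto simp: paths_def)

lemma finite_paths: "r \<le> M \<Longrightarrow> finite (paths M r a k)"
  by (induction r arbitrary: a k) (simp_all add: paths_0 paths_Suc)

lemma sum_paths_Suc:
  assumes "r < M"
  shows "(\<Sum>bs\<in>paths M (Suc r) a k. f bs) =
    (\<Sum>bs\<in>paths M r a k. f bs) + (if 0 < k then \<Sum>bs\<in>paths M r (M - r) (k - 1). f ((M - r) # bs) else 0)"
  unfolding paths_Suc[OF assms] using assms
  by (auto simp: sum.union_disjoint finite_paths paths_disjoint sum.reindex inj_on_def)

lemma card_paths_le: "r \<le> M \<Longrightarrow> card (paths M r a k) \<le> (r + 1) ^ k"
proof (induction r arbitrary: a k)
  case 0
  then show ?case by (simp add: paths_0)
next
  case (Suc r)
  have eq: "card (paths M (Suc r) a k) =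
      card (paths M r a k) + (if 0 < k then card (paths M r (M - r) (k - 1)) else 0)"
    using sum_paths_Suc[of r M "\<lambda>_. 1::nat" a k] Suc.prems by simp
  show ?case
  proof (cases k)
    case 0
    then show ?thesis using eq Suc.IH[of a 0] Suc.prems by simp
  next
    case (Suc k')
    have "card (paths M (Suc r) a k) \<le> (r + 1) ^ k + (r + 1) ^ k'"
      using eq Suc.IH[of a k] Suc.IH[of "M - r" k'] Suc.prems \<open>k = Suc k'\<close> by simp
    also have "\<dots> = (r + 2) * (r + 1) ^ k'" by (simp add: \<open>k = Suc k'\<close>)
    also have "\<dots> \<le> (r + 2) * (r + 2) ^ k'" by (intro mult_le_mono2 power_mono) auto
    finally show ?thesis by (simp add: \<open>k = Suc k'\<close>)
  qed
qed

lemma path_total_eq_sum: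
  "r \<le> M \<Longrightarrow> path_total M E r a k = (\<Sum>bs\<in>paths M r a k. path_weight E a bs)"
  by (induction r arbitrary: a k) (auto simp: paths_0 sum_paths_Suc sum_distrib_left)

lemma path_weight_nonneg: "(\<And>a b. 0 \<le> E a b) \<Longrightarrow> 0 \<le> path_weight E a bs"
  by (induction bs arbitrary: a) auto

section \<open>Law of the sampled path\<close>

lemma finite_set_sample: "finite (set_pmf (sample M E r a k))"
  by (induction r arbitrary: a k) auto

lemma path_total_nonneg: "(\<And>a b. 0 \<le> E a b) \<Longrightarrow> 0 \<le> path_total M E r a k"
  by (induction r arbitrary: a k) auto

lemma expectation_bind_bernoulli:
  fixes f :: "'a \<Rightarrow> real"
  assumes "0 \<le> p" "p \<le> 1" "finite (set_pmf A)" "finite (set_pmf B)"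
  shows "measure_pmf.expectation (bind_pmf (bernoulli_pmf p) (\<lambda>z. if z then A else B)) f =
    p * measure_pmf.expectation A f + (1 - p) * measure_pmf.expectation B f"
  using assms by (subst pmf_expectation_bind[where A = UNIV]) (auto simp: UNIV_bool)

text \<open>The conditional probabilities telescope: the numerator of each coin cancels the
  denominator of the next, leaving the weight of the path over the total. So the sampler draws
  exactly the Hedge distribution.\<close>

lemma expectation_sample:
  fixes f :: "nat list \<Rightarrow> real"
  assumes "\<And>a b. 0 \<le> E a b" "r \<le> M" "0 < path_total M E r a k"
  shows "measure_pmf.expectation (sample M E r a k) f =
    (\<Sum>bs\<in>paths M r a k. path_weight E a bs * f bs) / path_total M E r a k"
  using assms(2,3)
proof (induction r arbitrary: a k f)
  case 0
  then show ?case by (auto simp: paths_0)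
next
  case (Suc r)
  show ?case
  proof (cases "k = 0")
    case True
    then show ?thesis using Suc by (simp add: sum_paths_Suc)
  next
    case False
    define b where "b = M - r"
    define H where "H = path_total M E (Suc r) a k"
    define H1 where "H1 = path_total M E r a k"
    define H2 where "H2 = path_total M E r b (k - 1)"
    define S1 where "S1 = (\<Sum>bs\<in>paths M r a k. path_weight E a bs * f bs)"
    define S2 where "S2 = (\<Sum>bs\<in>paths M r b (k - 1). path_weight E b bs * f (b # bs))"
    define p where "p = E a b * H2 / H"
    have H: "H = H1 + E a b * H2" "0 < H" using False Suc.prems by (simp_all add: H_def H1_def H2_def b_def)
    have nonneg: "0 \<le> H1" "0 \<le> H2" "0 \<le> E a b"
      using assms(1) by (simp_all add: H1_def H2_def path_total_nonneg)
    have p: "0 \<le> p" "p \<le> 1" "1 - p = H1 / H" using H nonneg by (simp_all add: p_def field_simps)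
    have zero: "(\<Sum>bs\<in>paths M r a k. path_weight E a bs * g bs) = 0"
      if "path_total M E r a k = 0" for a k and g :: "nat list \<Rightarrow> real"
    proof -
      have "\<forall>bs\<in>paths M r a k. path_weight E a bs = 0"
        using that Suc.prems assms(1)
        by (subst (asm) path_total_eq_sum) (simp_all add: sum_nonneg_eq_0_iff finite_paths path_weight_nonneg)
      then show ?thesis by simp
    qed
    have 1: "(1 - p) * measure_pmf.expectation (sample M E r a k) f = S1 / H"
    proof (cases "H1 = 0")
      case True
      then show ?thesis using p zero[of a k f] by (simp add: S1_def H1_def)
    next
      case False
      then show ?thesis
        using p Suc.IH[of a k f] Suc.prems nonneg by (simp add: S1_def H1_def)
    qed
    have 2: "p * measure_pmf.expectation (sample M E r b (k - 1)) (\<lambda>bs. f (b # bs)) = E a b * S2 / H"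
    proof (cases "H2 = 0")
      case True
      then show ?thesis using zero[of b "k - 1" "\<lambda>bs. f (b # bs)"] by (simp add: S2_def H2_def p_def)
    next
      case False
      then show ?thesis
        using Suc.IH[of b "k - 1" "\<lambda>bs. f (b # bs)"] Suc.prems nonneg by (simp add: S2_def H2_def p_def)
    qed
    have "sample M E (Suc r) a k = bind_pmf (bernoulli_pmf p)
        (\<lambda>z. if z then map_pmf ((#) b) (sample M E r b (k - 1)) else sample M E r a k)"
      unfolding p_def H_def H2_def b_def using False by simp
    then have "measure_pmf.expectation (sample M E (Suc r) a k) f =
        p * measure_pmf.expectation (sample M E r b (k - 1)) (\<lambda>bs. f (b # bs)) +
        (1 - p) * measure_pmf.expectation (sample M E r a k) f"
      by (simp only: expectation_bind_bernoulli[OF p(1,2)] finite_set_sample set_map_pmf finite_imageI integral_map_pmf)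
    also have "\<dots> = (S1 + E a b * S2) / H"
      unfolding 1 2 by (simp add: add_divide_distrib)
    also have "S1 + E a b * S2 = (\<Sum>bs\<in>paths M (Suc r) a k. path_weight E a bs * f bs)"
      using False Suc.prems by (simp add: sum_paths_Suc S1_def S2_def b_def sum_distrib_left mult.assoc)
    finally show ?thesis by (simp only: H_def)
  qed
qed

text \<open>All coins have bias 0. Through this, the learner submits no bid for a context that
  admits no strategy.\<close>

lemma sample_degenerate:
  "(\<And>a b. 0 \<le> E a b) \<Longrightarrow> path_total M E r a k = 0 \<Longrightarrow> sample M E r a k = return_pmf []"
proof (induction r arbitrary: a k)
  case (Suc r)
  have "0 \<le> path_total M E r a k" "0 \<le> (if 0 < k then E a (M - r) * path_total M E r (M - r) (k - 1) else 0)"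
    using Suc.prems(1) by (simp_all add: path_total_nonneg)
  with Suc.prems(2) have "path_total M E r a k = 0" by simp
  moreover have "bernoulli_pmf 0 = return_pmf False"
  proof (rule pmf_eqI)
    show "pmf (bernoulli_pmf 0) z = pmf (return_pmf False) z" for z
      by (cases z) simp_all
  qed
  moreover have "k = 0 \<or> E a (M - r) * path_total M E r (M - r) (k - 1) = 0"
    using Suc.prems(2) calculation(1) by (auto split: if_splits)
  ultimately show ?case
    using Suc by (cases "k = 0") (simp_all add: bind_return_pmf del: mult_eq_0_iff)
qed simp

text \<open>The formula for expectations, applied to the indicator of a single path, gives its
  probability.\<close>

lemma set_sample:
  assumes "\<And>a b. 0 \<le> E a b" "r \<le> M" "0 < path_total M E r a k" "bs \<in> set_pmf (sample M E r a k)"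
  shows "bs \<in> paths M r a k" "path_weight E a bs \<noteq> 0"
proof -
  have "0 < pmf (sample M E r a k) bs"
    using assms(4) by (simp add: pmf_positive)
  also have "pmf (sample M E r a k) bs = measure_pmf.expectation (sample M E r a k) (indicator {bs})"
    by (simp add: pmf.rep_eq)
  also have "\<dots> = (\<Sum>cs\<in>paths M r a k. path_weight E a cs * indicator {bs} cs) / path_total M E r a k"
    by (rule expectation_sample[OF assms(1-3)])
  finally have "0 \<noteq> (\<Sum>cs\<in>paths M r a k. path_weight E a cs * indicator {bs} cs)"
    using assms(3) by auto
  also have "(\<Sum>cs\<in>paths M r a k. path_weight E a cs * indicator {bs} cs) =
      (if bs \<in> paths M r a k then path_weight E a bs else 0)"
    using finite_paths[OF assms(2)] by (simp add: indicator_def if_distrib cong: if_cong)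
  finally show "bs \<in> paths M r a k" "path_weight E a bs \<noteq> 0"
    by (auto split: if_splits)
qed

section \<open>Hedge\<close>

text \<open>The difference of the two sides has derivative exp (-y) - (1 - y) >= 0. Validity for all
  x >= 0 lets the Hedge bound cover every horizon, even where \<eta> L exceeds 1.\<close>

lemma exp_minus_le_quadratic:
  fixes x :: real assumes "0 \<le> x" shows "exp (- x) \<le> 1 - x + x\<^sup>2 / 2"
proof -
  let ?f = "\<lambda>x :: real. 1 - x + x\<^sup>2 / 2 - exp (- x)"
  have "?f 0 \<le> ?f x"
  proof (rule DERIV_nonneg_imp_nondecreasing[OF assms])
    fix y :: real assume "0 \<le> y"
    have "(?f has_real_derivative (- 1 + y + exp (- y))) (at y)"
      by (auto intro!: derivative_eq_intros)
    moreover have "1 + - y \<le> exp (- y)" by (rule exp_ge_add_one_self)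
    ultimately show "\<exists>D. (?f has_real_derivative D) (at y) \<and> 0 \<le> D" by force
  qed
  then show ?thesis by simp
qed

text \<open>Potential argument: the total weight grows per round by at most the factor exp (\<eta>
  avg + \<eta>^2 L^2 / 2), and in the end it is at least the weight of the comparator.\<close>

lemma hedge_regret:
  fixes g :: "nat \<Rightarrow> 'a \<Rightarrow> real"
  assumes X: "finite X" "x\<^sub>0 \<in> X" and \<eta>: "0 < \<eta>"
    and g: "\<And>t x. t < T \<Longrightarrow> x \<in> X \<Longrightarrow> 0 \<le> g t x \<and> g t x \<le> L"
  defines "W \<equiv> \<lambda>t x. exp (\<eta> * (\<Sum>s<t. g s x))"
  shows "(\<Sum>t<T. g t x\<^sub>0) - (\<Sum>t<T. (\<Sum>x\<in>X. W t x * g t x) / (\<Sum>x\<in>X. W t x))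
    \<le> ln (real (card X)) / \<eta> + \<eta> * real T * L\<^sup>2 / 2"
proof -
  define \<Phi> where "\<Phi> t = (\<Sum>x\<in>X. W t x)" for t
  define avg where "avg t = (\<Sum>x\<in>X. W t x * g t x) / \<Phi> t" for t
  have pos: "0 < \<Phi> t" for t
    unfolding \<Phi>_def W_def using X by (intro sum_pos) auto
  have step: "\<Phi> (Suc t) \<le> \<Phi> t * exp (\<eta> * avg t + \<eta>\<^sup>2 * L\<^sup>2 / 2)" if t: "t < T" for t
  proof -
    have "W (Suc t) x \<le> exp (\<eta> * L) * (W t x * (1 - \<eta> * L + \<eta>\<^sup>2 * L\<^sup>2 / 2) + \<eta> * (W t x * g t x))" if x: "x \<in> X" for x
    proof -
      \<comment> \<open>Gains are turned into losses L - g >= 0, to which the quadratic bound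
        applies; the factor exp (\<eta> L) restores them.\<close>
      let ?y = "\<eta> * (L - g t x)"
      have y: "0 \<le> ?y" "?y \<le> \<eta> * L" using g[OF t x] \<eta> by auto
      have "exp (- ?y) \<le> 1 - ?y + ?y\<^sup>2 / 2" by (rule exp_minus_le_quadratic[OF y(1)])
      also have "?y\<^sup>2 \<le> (\<eta> * L)\<^sup>2" using y by (intro power_mono)
      finally have e: "exp (- ?y) \<le> 1 - \<eta> * L + \<eta> * g t x + \<eta>\<^sup>2 * L\<^sup>2 / 2"
        by (simp add: algebra_simps power_mult_distrib)
      have "W (Suc t) x = W t x * exp (\<eta> * L) * exp (- ?y)"
        by (simp add: W_def algebra_simps flip: exp_add)
      also have "\<dots> \<le> W t x * exp (\<eta> * L) * (1 - \<eta> * L + \<eta> * g t x + \<eta>\<^sup>2 * L\<^sup>2 / 2)"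
        by (intro mult_left_mono e) (simp add: W_def)
      finally show ?thesis by (simp add: algebra_simps)
    qed
    then have "\<Phi> (Suc t) \<le> (\<Sum>x\<in>X. exp (\<eta> * L) * (W t x * (1 - \<eta> * L + \<eta>\<^sup>2 * L\<^sup>2 / 2) + \<eta> * (W t x * g t x)))"
      unfolding \<Phi>_def by (rule sum_mono)
    also have "\<dots> = exp (\<eta> * L) * (\<Phi> t * (1 - \<eta> * L + \<eta>\<^sup>2 * L\<^sup>2 / 2) + \<eta> * (\<Sum>x\<in>X. W t x * g t x))"
      by (simp add: \<Phi>_def sum.distrib flip: sum_distrib_left sum_distrib_right)
    also have "(\<Sum>x\<in>X. W t x * g t x) = \<Phi> t * avg t"
      using pos[of t] by (simp add: avg_def)
    also have "exp (\<eta> * L) * (\<Phi> t * (1 - \<eta> * L + \<eta>\<^sup>2 * L\<^sup>2 / 2) + \<eta> * (\<Phi> t * avg t)) =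
        \<Phi> t * (exp (\<eta> * L) * (1 + (- \<eta> * L + \<eta> * avg t + \<eta>\<^sup>2 * L\<^sup>2 / 2)))"
      by (simp add: algebra_simps)
    also have "\<dots> \<le> \<Phi> t * (exp (\<eta> * L) * exp (- \<eta> * L + \<eta> * avg t + \<eta>\<^sup>2 * L\<^sup>2 / 2))"
      using pos[of t] by (intro mult_left_mono exp_ge_add_one_self) auto
    finally show ?thesis by (simp flip: exp_add)
  qed
  have "\<Phi> t \<le> real (card X) * exp (\<eta> * (\<Sum>s<t. avg s) + real t * (\<eta>\<^sup>2 * L\<^sup>2 / 2))" if "t \<le> T" for t
    using that
  proof (induction t)
    case 0
    then show ?case by (simp add: \<Phi>_def W_def)
  next
    case (Suc t)
    have "\<Phi> (Suc t) \<le> \<Phi> t * exp (\<eta> * avg t + \<eta>\<^sup>2 * L\<^sup>2 / 2)" using Suc step by simp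
    also have "\<dots> \<le> real (card X) * exp (\<eta> * (\<Sum>s<t. avg s) + real t * (\<eta>\<^sup>2 * L\<^sup>2 / 2)) * exp (\<eta> * avg t + \<eta>\<^sup>2 * L\<^sup>2 / 2)"
      using Suc by (intro mult_right_mono) auto
    also have "\<dots> = real (card X) * exp (\<eta> * (\<Sum>s<Suc t. avg s) + real (Suc t) * (\<eta>\<^sup>2 * L\<^sup>2 / 2))"
      by (simp add: algebra_simps flip: exp_add)
    finally show ?case .
  qed
  moreover have "W T x\<^sub>0 \<le> \<Phi> T"
    unfolding \<Phi>_def using X by (intro member_le_sum) (auto simp: W_def)
  ultimately have "W T x\<^sub>0 \<le> real (card X) * exp (\<eta> * (\<Sum>s<T. avg s) + real T * (\<eta>\<^sup>2 * L\<^sup>2 / 2))"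
    by (meson order_refl order_trans)
  moreover have card: "0 < real (card X)" using X by (auto simp: card_gt_0_iff)
  ultimately have "W T x\<^sub>0 \<le> exp (ln (real (card X)) + (\<eta> * (\<Sum>s<T. avg s) + real T * (\<eta>\<^sup>2 * L\<^sup>2 / 2)))"
    by (simp add: exp_add)
  then have "\<eta> * (\<Sum>t<T. g t x\<^sub>0) \<le> ln (real (card X)) + (\<eta> * (\<Sum>s<T. avg s) + real T * (\<eta>\<^sup>2 * L\<^sup>2 / 2))"
    by (simp add: W_def)
  then have "\<eta> * ((\<Sum>t<T. g t x\<^sub>0) - (\<Sum>s<T. avg s)) \<le> \<eta> * (ln (real (card X)) / \<eta> + \<eta> * real T * L\<^sup>2 / 2)"
    using \<eta> by (simp add: algebra_simps power2_eq_square)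
  then show ?thesis
    using \<eta> by (simp add: avg_def \<Phi>_def)
qed

section \<open>Strategies as paths\<close>

primrec path_ok :: "valuation \<Rightarrow> nat \<Rightarrow> nat list \<Rightarrow> bool" where
  "path_ok v a [] \<longleftrightarrow> True"
| "path_ok v a (b # bs) \<longleftrightarrow> edge_ok v a b \<and> path_ok v b bs"

primrec path_sum :: "(nat \<Rightarrow> nat \<Rightarrow> real) \<Rightarrow> nat \<Rightarrow> nat list \<Rightarrow> real" where
  "path_sum S a [] = 0"
| "path_sum S a (b # bs) = S a b + path_sum S b bs"

text \<open>The exponential turns additive edge gains into a product, and a forbidden edge
  contributes the factor 0. This lets a dynamic program over edges represent Hedge over
  paths.\<close>

lemma path_weight_edge_weight:
  "path_weight (edge_weight P v S) a bs =
     (if path_ok v a bs then exp (learning_rate P * path_sum S a bs) else 0)"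
  by (induction bs arbitrary: a) (auto simp: edge_weight_def exp_add algebra_simps)

lemma path_sum_sum: "path_sum (\<lambda>a b. \<Sum>t\<in>A. S t a b) a bs = (\<Sum>t\<in>A. path_sum (S t) a bs)"
  by (induction bs arbitrary: a) (auto simp: sum.distrib)

text \<open>Node 0 must not recur, since \<open>edge_ok\<close> waives the comparison of bids
  there.\<close>

lemma path_ok_decreasing:
  "path_ok v a bs \<Longrightarrow> 0 \<notin> set bs \<Longrightarrow> sorted_wrt (>) (map (avg_value v) bs) \<and>
     (\<forall>b\<in>set bs. 0 < avg_value v b \<and> (a = 0 \<or> avg_value v b < avg_value v a))"
  by (induction bs arbitrary: a) (force simp: edge_ok_def)+

lemma path_strategy_simps [simp]:
  "length (path_strategy w a bs) = length bs"
  "map fst (path_strategy w a bs) = map w bs"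
  by (induction bs arbitrary: a) auto

text \<open>Quantities are differences of consecutive nodes, so their sums telescope; strict
  monotonicity makes the natural subtraction exact.\<close>

lemma path_strategy_prefix_sum:
  "sorted_wrt (<) (a # bs) \<Longrightarrow> l < length bs \<Longrightarrow>
     a + sum_list (take (Suc l) (map snd (path_strategy w a bs))) = bs ! l"
proof (induction bs arbitrary: a l)
  case (Cons b bs)
  then show ?case
    by (cases l) (force, fastforce)
qed simp

lemma path_strategy_quantities_pos:
  "sorted_wrt (<) (a # bs) \<Longrightarrow> q \<in> set (map snd (path_strategy w a bs)) \<Longrightarrow> 0 < q"
  by (induction bs arbitrary: a) auto

lemma path_strategy_admissible:
  assumes "bs \<in> paths M M 0 m" "path_ok v 0 bs" "length v = M"
  shows "path_strategy (avg_value v) 0 bs \<in> avg_strategies m v"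
proof -
  let ?s = "path_strategy (avg_value v) 0 bs"
  have bs: "sorted_wrt (<) (0 # bs)" "set bs \<subseteq> {0<..M}" "length bs \<le> m" "bs \<noteq> []"
    using assms(1) by (auto simp: paths_def)
  have dec: "sorted_wrt (>) (map (avg_value v) bs)" "\<forall>b\<in>set bs. 0 < avg_value v b"
    using path_ok_decreasing[OF assms(2)] bs by auto
  have "b > 0 \<and> q > 0" if "(b, q) \<in> set ?s" for b q
  proof -
    have "b \<in> set (map fst ?s)" "q \<in> set (map snd ?s)"
      using that by (force simp del: path_strategy_simps)+
    then show ?thesis
      using dec(2) path_strategy_quantities_pos[OF bs(1)] by auto
  qed
  moreover have "sum_list (map snd ?s) \<le> M"
  proof -
    \<comment> \<open>The total quantity is the last node of the path.\<close>
    have "sum_list (take (Suc (length bs - 1)) (map snd ?s)) = bs ! (length bs - 1)"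
      using path_strategy_prefix_sum[OF bs(1), of "length bs - 1"] bs(4) by simp
    moreover have "bs ! (length bs - 1) \<in> set bs" using bs(4) by simp
    then have "bs ! (length bs - 1) \<le> M" using bs(2) by (meson greaterThanAtMost_iff subsetD)
    ultimately show ?thesis using bs(4) by simp
  qed
  moreover have "fst (?s ! l) = avg_value v (sum_list (take (Suc l) (map snd ?s)))" if "l < length bs" for l
  proof -
    have "fst (?s ! l) = map fst ?s ! l"
      using that by (simp only: nth_map path_strategy_simps(1))
    also have "\<dots> = avg_value v (bs ! l)" using that by simp
    finally show ?thesis using path_strategy_prefix_sum[OF bs(1) that] by simp
  qed
  moreover have "length bs \<in> {1..m}" using bs by (cases bs) auto
  ultimately show ?thesis
    using dec(1) assms(3) unfolding avg_strategies_def uniform_strategies_def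
    by (intro UN_I[of "length bs"]) auto
qed

primrec strategy_path :: "nat \<Rightarrow> strategy \<Rightarrow> nat list" where
  "strategy_path a [] = []"
| "strategy_path a (x # s) = (a + snd x) # strategy_path (a + snd x) s"

text \<open>The nodes are the partial sums Q_l. The start a and the condition that all bids lie
  below its average make the statement inductive.\<close>

lemma strategy_path_props:
  assumes "\<forall>(b, q)\<in>set s. 0 < b \<and> 0 < q"
    and "\<forall>l<length s. fst (s ! l) = avg_value v (a + sum_list (take (Suc l) (map snd s)))"
    and "sorted_wrt (>) (map fst s)" "a = 0 \<or> (\<forall>b\<in>set (map fst s). b < avg_value v a)"
  shows "path_strategy (avg_value v) a (strategy_path a s) = s \<and> path_ok v a (strategy_path a s) \<and>
    sorted_wrt (<) (a # strategy_path a s) \<and> set (strategy_path a s) \<subseteq> {..a + sum_list (map snd s)} \<and>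
    length (strategy_path a s) = length s"
  using assms
proof (induction s arbitrary: a)
  case (Cons x s)
  obtain c q where x: "x = (c, q)" by fastforce
  have c: "c = avg_value v (a + q)" using Cons.prems(2) by (auto simp: x dest: spec[of _ 0])
  have "\<forall>l<length s. fst (s ! l) = avg_value v (a + q + sum_list (take (Suc l) (map snd s)))"
  proof (intro allI impI)
    fix l assume "l < length s"
    then show "fst (s ! l) = avg_value v (a + q + sum_list (take (Suc l) (map snd s)))"
      using Cons.prems(2)[rule_format, of "Suc l"] by (simp add: x add.assoc)
  qed
  then have IH: "path_strategy (avg_value v) (a + q) (strategy_path (a + q) s) = s \<and> path_ok v (a + q) (strategy_path (a + q) s) \<and>
    sorted_wrt (<) ((a + q) # strategy_path (a + q) s) \<and> set (strategy_path (a + q) s) \<subseteq> {..a + q + sum_list (map snd s)} \<and>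
    length (strategy_path (a + q) s) = length s"
    using Cons.prems c by (intro Cons.IH) (auto simp: x)
  with Cons.prems c show ?case
    by (fastforce simp: x edge_ok_def)
qed simp

lemma avg_strategies_path:
  assumes "s \<in> avg_strategies m v" "length v = M"
  obtains bs where "bs \<in> paths M M 0 m" "path_ok v 0 bs" "path_strategy (avg_value v) 0 bs = s"
proof -
  have s: "length s \<in> {1..m}" "sorted_wrt (>) (map fst s)" "\<forall>(b, q)\<in>set s. 0 < b \<and> 0 < q"
      "sum_list (map snd s) \<le> M"
      "\<forall>l<length s. fst (s ! l) = avg_value v (0 + sum_list (take (Suc l) (map snd s)))"
    using assms by (auto simp: avg_strategies_def uniform_strategies_def)
  let ?bs = "strategy_path 0 s"
  have p: "path_strategy (avg_value v) 0 ?bs = s \<and> path_ok v 0 ?bs \<and>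
    sorted_wrt (<) (0 # ?bs) \<and> set ?bs \<subseteq> {..0 + sum_list (map snd s)} \<and> length ?bs = length s"
    using s by (intro strategy_path_props) auto
  then have "?bs \<in> paths M M 0 m" using s(1,4) by (fastforce simp: paths_def)
  with p that show thesis by blast
qed

section \<open>Auction value as a sum of edge gains\<close>

definition wins :: "nat \<Rightarrow> real list \<Rightarrow> nat \<Rightarrow> real \<Rightarrow> bool" where
  "wins K \<beta> j c \<longleftrightarrow> j + length (filter (\<lambda>x. x > c) \<beta>) + 1 \<le> K"

text \<open>In a nonincreasing list the bids above w form a prefix, so counting them amounts to
  inspecting one entry. The default 0 beyond the end is harmless because 0 <= w.\<close>

lemma filter_greater_le_iff:
  assumes "sorted_wrt (\<ge>) \<beta>" "\<forall>c\<in>set \<beta>. 0 \<le> c" "0 \<le> (w :: real)"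
  shows "length (filter (\<lambda>c. c > w) \<beta>) \<le> n \<longleftrightarrow> entry \<beta> n \<le> w"
  using assms(1,2)
proof (induction \<beta> arbitrary: n)
  case Nil
  then show ?case using assms(3) by (simp add: entry_def)
next
  case (Cons c \<beta>)
  show ?case
  proof (cases "c > w")
    case True
    then show ?thesis using Cons by (cases n) (auto simp: entry_def)
  next
    case False
    then have "filter (\<lambda>c. c > w) (c # \<beta>) = []" using Cons.prems by (auto simp: filter_empty_conv)
    moreover have "entry (c # \<beta>) n \<le> w"
      using False Cons.prems assms(3) by (cases n) (auto simp: entry_def, fastforce dest: nth_mem)
    ultimately show ?thesis by simp
  qed
qed

lemma wins_iff_entry:
  assumes "\<beta> \<in> competing_bids" "0 \<le> w"
  shows "wins K \<beta> j w \<longleftrightarrow> Suc j \<le> K \<and> entry \<beta> (K - Suc j) \<le> w"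
  using filter_greater_le_iff[of \<beta> w "K - Suc j"] assms
  by (auto simp: wins_def competing_bids_def)

lemma downward_closed_eq_lessThan:
  assumes "finite A" "\<And>i j. i \<in> A \<Longrightarrow> j < i \<Longrightarrow> j \<in> A"
  shows "A = {..<card A}"
proof -
  define n where "n = (LEAST n. n \<notin> A)"
  have ex: "\<exists>n. n \<notin> A" using assms(1) ex_new_if_finite infinite_UNIV_nat by blast
  have "n \<notin> A" unfolding n_def using ex by (rule LeastI_ex)
  moreover have "j \<in> A" if "j < n" for j using not_less_Least that unfolding n_def by blast
  ultimately have "A = {..<n}" using assms(2) by (metis lessThan_iff linorder_neqE_nat subsetI subset_antisym)
  then show ?thesis by simp
qed

text \<open>An earlier bid is at least as high, is exceeded by no more competing bids and has fewer
  own bids ahead of it. So the winning positions form an initial segment.\<close>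

lemma sum_take_units_won:
  assumes "sorted_wrt (\<ge>) b" "length b \<le> length v"
  shows "sum_list (take (units_won K b \<beta>) v) = (\<Sum>j<length b. if wins K \<beta> j (b ! j) then v ! j else (0::real))"
proof -
  define A where "A = {j. j < length b \<and> wins K \<beta> j (b ! j)}"
  have "j \<in> A" if "i \<in> A" "j < i" for i j
  proof -
    have "b ! j \<ge> b ! i" using assms(1) that by (auto simp: sorted_wrt_iff_nth_less A_def)
    then have "length (filter (\<lambda>x. x > b ! j) \<beta>) \<le> length (filter (\<lambda>x. x > b ! i) \<beta>)"
      by (induction \<beta>) auto
    then show ?thesis using that by (auto simp: A_def wins_def)
  qed
  then have A: "A = {..<units_won K b \<beta>}"
    using downward_closed_eq_lessThan[of A] by (simp add: A_def units_won_def wins_def)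
  have "units_won K b \<beta> \<le> length b"
    using A by (force simp: A_def)
  then have "sum_list (take (units_won K b \<beta>) v) = (\<Sum>j\<in>A. v ! j)"
    using assms(2) by (subst A) (simp add: sum_list_sum_nth atLeast0LessThan min_absorb2)
  also have "A = {j\<in>{..<length b}. wins K \<beta> j (b ! j)}"
    by (auto simp: A_def)
  also have "(\<Sum>j\<in>\<dots>. v ! j) = (\<Sum>j<length b. if wins K \<beta> j (b ! j) then v ! j else 0)"
    by (rule sum.inter_filter) simp
  finally show ?thesis .
qed

lemma sum_lessThan_add:
  fixes f :: "nat \<Rightarrow> real"
  shows "(\<Sum>j<m + n. f j) = (\<Sum>j<m. f j) + (\<Sum>j<n. f (m + j))"
  by (induction n) auto

lemma bid_vector_path_strategy_Cons:
  "bid_vector (path_strategy w a (b # bs)) = replicate (b - a) (w b) @ bid_vector (path_strategy w b bs)"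
  by (simp add: bid_vector_def)

text \<open>The edge (a, b) owns exactly the positions a, ..., b - 1. Counting positions from a
  keeps them absolute throughout the recursion.\<close>

lemma sum_bid_vector_path_strategy:
  "sorted_wrt (<) (a # bs) \<Longrightarrow>
   (\<Sum>j<length (bid_vector (path_strategy w a bs)). f (a + j) (bid_vector (path_strategy w a bs) ! j)) =
   path_sum (\<lambda>a b. \<Sum>j\<in>{a..<b}. f j (w b)) a bs"
proof (induction bs arbitrary: a)
  case Nil
  then show ?case by (simp add: bid_vector_def)
next
  case (Cons b bs)
  then have "a < b" "sorted_wrt (<) (b # bs)" by auto
  have "(\<Sum>j<b - a. f (a + j) (w b)) = (\<Sum>j\<in>{a..<b}. f j (w b))"
    using \<open>a < b\<close> by (intro sum.reindex_bij_witness[of _ "\<lambda>j. j - a" "\<lambda>j. a + j"]) auto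
  moreover have "\<not> b + j - a < b - a" "b + j - a - (b - a) = j" for j
    using \<open>a < b\<close> by auto
  ultimately show ?case
    using Cons.IH[OF \<open>sorted_wrt (<) (b # bs)\<close>] \<open>a < b\<close>
    unfolding bid_vector_path_strategy_Cons length_append length_replicate sum_lessThan_add
    by (simp add: nth_append flip: add.assoc)
qed

lemma length_bid_vector_path_strategy:
  "sorted_wrt (<) (a # bs) \<Longrightarrow> set (a # bs) \<subseteq> {..M} \<Longrightarrow>
   a + length (bid_vector (path_strategy w a bs)) \<le> M"
  by (induction bs arbitrary: a) (force simp: bid_vector_def)+

lemma sorted_bid_vector_path_strategy:
  "sorted_wrt (>) (map w bs) \<Longrightarrow> sorted_wrt (\<ge>) (bid_vector (path_strategy w a bs)) \<and>
     set (bid_vector (path_strategy w a bs)) \<subseteq> set (map w bs)"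
proof (induction bs arbitrary: a)
  case Nil
  then show ?case by (simp add: bid_vector_def)
next
  case (Cons b bs)
  then show ?case
    unfolding bid_vector_path_strategy_Cons
    by (fastforce simp: sorted_wrt_append sorted_wrt_iff_nth_less[of _ "replicate _ _"] intro: less_imp_le)
qed

text \<open>Agreement is demanded on admissible edges only, because the rank test for winning
  presupposes a nonnegative bid.\<close>

lemma path_sum_cong:
  assumes "sorted_wrt (<) (a # bs)" "set bs \<subseteq> {..M}" "path_ok v a bs"
    and "\<And>a b. a < b \<Longrightarrow> b \<le> M \<Longrightarrow> edge_ok v a b \<Longrightarrow> S a b = S' a b"
  shows "path_sum S a bs = path_sum S' a bs"
  using assms(1-3) by (induction bs arbitrary: a) (auto simp: assms(4))

lemma auction_value_path_strategy:
  assumes "bs \<in> paths M M 0 m" "path_ok v 0 bs" "length v = M" "\<beta> \<in> competing_bids"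
  shows "auction_value K v (path_strategy (avg_value v) 0 bs) \<beta> = path_sum (edge_value K v \<beta>) 0 bs"
proof -
  let ?b = "bid_vector (path_strategy (avg_value v) 0 bs)"
  define f where "f j c = (if wins K \<beta> j c then v ! j else 0)" for j c
  have bs: "sorted_wrt (<) (0 # bs)" "set bs \<subseteq> {0<..M}"
    using assms(1) by (auto simp: paths_def)
  have "sorted_wrt (\<ge>) ?b"
    using sorted_bid_vector_path_strategy path_ok_decreasing[OF assms(2)] bs by auto
  moreover have "length ?b \<le> length v"
    using length_bid_vector_path_strategy[OF bs(1), of M "avg_value v"] bs assms(3) by fastforce
  ultimately have "auction_value K v (path_strategy (avg_value v) 0 bs) \<beta> = (\<Sum>j<length ?b. f (0 + j) (?b ! j))"
    by (simp add: auction_value_def sum_take_units_won f_def)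
  also have "\<dots> = path_sum (\<lambda>a b. \<Sum>j\<in>{a..<b}. f j (avg_value v b)) 0 bs"
    by (rule sum_bid_vector_path_strategy[OF bs(1)])
  also have "\<dots> = path_sum (edge_value K v \<beta>) 0 bs"
  proof (rule path_sum_cong[OF bs(1) _ assms(2)])
    fix a b assume b: "b \<le> M" "edge_ok v a b"
    then have w: "0 \<le> avg_value v b" by (simp add: edge_ok_def)
    have "(\<Sum>j\<in>{a..<b}. f j (avg_value v b)) = (\<Sum>j\<in>{j\<in>{..<length v}. a \<le> j \<and> Suc j \<le> b}. f j (avg_value v b))"
      using b assms(3) by (intro sum.cong) auto
    also have "\<dots> = (\<Sum>j<length v. if a \<le> j \<and> Suc j \<le> b then f j (avg_value v b) else 0)"
      by (rule sum.inter_filter) simp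
    also have "\<dots> = edge_value K v \<beta> a b"
      unfolding edge_value_def f_def wins_iff_entry[OF assms(4) w] by (intro sum.cong) auto
    finally show "(\<Sum>j\<in>{a..<b}. f j (avg_value v b)) = edge_value K v \<beta> a b" .
  qed (use bs in auto)
  finally show ?thesis .
qed

lemma auction_value_bounds:
  assumes "v \<in> valuations M"
  shows "0 \<le> auction_value K v s \<beta>" "auction_value K v s \<beta> \<le> real M"
proof -
  define n where "n = units_won K (bid_vector s) \<beta>"
  have v: "length v = M" "\<And>x. x \<in> set (take n v) \<Longrightarrow> 0 \<le> x \<and> x \<le> 1"
    using assms by (auto simp: valuations_def dest: in_set_takeD)
  show "0 \<le> auction_value K v s \<beta>"
    using v by (auto simp: auction_value_def n_def[symmetric] intro!: sum_list_nonneg)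
  have "sum_list (take n v) \<le> sum_list (map (\<lambda>_. 1) (take n v))"
    using v sum_list_mono[of "take n v" "\<lambda>x. x" "\<lambda>_. 1"] by simp
  also have "\<dots> \<le> real M" using v by (simp add: sum_list_triv)
  finally show "auction_value K v s \<beta> \<le> real M"
    by (simp add: auction_value_def n_def)
qed

lemma auction_value_Nil [simp]: "auction_value K v [] \<beta> = 0"
  by (simp add: auction_value_def units_won_def bid_vector_def)

section \<open>Regret of the algorithm\<close>

lemma path_total_cong:
  assumes "\<And>a b. a \<le> M \<Longrightarrow> b \<le> M \<Longrightarrow> E a b = E' a b"
  shows "a \<le> M \<Longrightarrow> path_total M E r a k = path_total M E' r a k"
  by (induction r arbitrary: a k) (auto simp: assms)

text \<open>Needed because the memory is known to hold the accumulated gains only for nodes up to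
  M.\<close>

lemma sample_cong:
  assumes "\<And>a b. a \<le> M \<Longrightarrow> b \<le> M \<Longrightarrow> E a b = E' a b"
  shows "a \<le> M \<Longrightarrow> sample M E r a k = sample M E' r a k"
proof (induction r arbitrary: a k)
  case (Suc r)
  then show ?case
    using path_total_cong[of M E E', OF assms] assms[of a "M - r"]
    by (auto simp del: path_total.simps intro!: bind_pmf_cong)
qed simp

section \<open>Memory between rounds, running time and space\<close>

definition cumulative :: "problem \<Rightarrow> (nat \<Rightarrow> real list) \<Rightarrow> nat \<Rightarrow> valuation \<Rightarrow> nat \<Rightarrow> nat \<Rightarrow> real" where
  "cumulative P \<beta> t v a b = (\<Sum>s<t. edge_value (units P) v (\<beta> s) a b)"

definition hedge_paths :: "problem \<Rightarrow> (nat \<Rightarrow> real list) \<Rightarrow> nat \<Rightarrow> valuation \<Rightarrow> nat list pmf" where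
  "hedge_paths P \<beta> t v =
     sample (demand P) (edge_weight P v (cumulative P \<beta> t v)) (demand P) 0 (strat_bound P)"

text \<open>The right-hand side involves neither drawn contexts nor coins: the learning state is
  deterministic.\<close>

definition state_invariant :: "problem \<Rightarrow> (nat \<Rightarrow> real list) \<Rightarrow> nat \<Rightarrow> config \<Rightarrow> bool" where
  "state_invariant P \<beta> t \<sigma> \<longleftrightarrow>
     (\<forall>i<length (contexts P). \<forall>a\<le>demand P. \<forall>b\<le>demand P.
        rmem \<sigma> (''S'', [i, a, b]) = cumulative P \<beta> t (contexts P ! i) a b)"

definition programs :: com where
  "programs = Seq (bid_prog hedge_algorithm) (update_prog hedge_algorithm)"

lemma finite_vars: "finite (nvars c)" "finite (rvars c)"
  by (induction c) auto

lemma tame_hedge_algorithm: "tame (bid_prog hedge_algorithm)" "tame (update_prog hedge_algorithm)"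
  by (simp_all add: hedge_algorithm_def com_defs)

lemma after_rounds_invariant:
  assumes P: "valid_problem P" and F: "set_pmf F \<subseteq> set (contexts P)"
  shows "\<sigma> \<in> set_pmf (after_rounds hedge_algorithm P F \<beta> t) \<Longrightarrow>
    state_invariant P \<beta> t \<sigma> \<and> bounded_config (size_bound P) (nvars programs) (rvars programs) \<sigma> \<and>
    (0 < t \<longrightarrow> steps \<sigma> \<le> cost (size_bound P) programs)"
proof (induction t arbitrary: \<sigma>)
  case 0
  then show ?case
    by (auto simp: init_config_def state_invariant_def bounded_config_def cumulative_def)
next
  case (Suc t)
  let ?B = "size_bound P"
  let ?bounded = "bounded_config ?B (nvars programs) (rvars programs)"
  obtain \<sigma>\<^sub>0 v \<rho> where \<sigma>\<^sub>0: "\<sigma>\<^sub>0 \<in> set_pmf (after_rounds hedge_algorithm P F \<beta> t)" and "v \<in> set_pmf F"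
    and \<rho>: "\<rho> \<in> set_pmf (exec (bid_input P v) (bid_prog hedge_algorithm) (\<sigma>\<^sub>0\<lparr>steps := 0\<rparr>))"
    and \<sigma>: "\<sigma> \<in> set_pmf (exec (update_input P v (\<beta> t)) (update_prog hedge_algorithm) \<rho>)"
    using Suc.prems by (auto simp: bid_phase_def)
  have "?bounded (\<sigma>\<^sub>0\<lparr>steps := 0\<rparr>)"
    using Suc.IH[OF \<sigma>\<^sub>0] by (simp add: bounded_config_def)
  then have 1: "?bounded \<rho> \<and> steps \<rho> \<le> cost ?B (bid_prog hedge_algorithm)"
    using wp_tame[OF tame_hedge_algorithm(1), of "nvars programs" "rvars programs" ?B "bid_input P v" "\<sigma>\<^sub>0\<lparr>steps := 0\<rparr>"] \<rho>
    by (auto simp: wp_def programs_def bid_input_def)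
  then have 2: "?bounded \<sigma> \<and> steps \<sigma> \<le> steps \<rho> + cost ?B (update_prog hedge_algorithm)"
    using wp_tame[OF tame_hedge_algorithm(2), of "nvars programs" "rvars programs" ?B "update_input P v (\<beta> t)" \<rho>] \<sigma>
    by (auto simp: wp_def programs_def update_input_def)
  \<comment> \<open>Bidding leaves the accumulated gains untouched, so only the update has to be
    followed.\<close>
  have "''S'' \<notin> rvars (bid_prog hedge_algorithm)"
    by (simp add: hedge_algorithm_def com_defs)
  then have "rmem \<rho> (''S'', js) = rmem \<sigma>\<^sub>0 (''S'', js)" for js
    using wp_agree_off[OF order_refl order_refl, of _ "\<sigma>\<^sub>0\<lparr>steps := 0\<rparr>" "\<sigma>\<^sub>0\<lparr>steps := 0\<rparr>"] \<rho>
    by (fastforce simp: wp_def agree_off_def)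
  moreover have "\<forall>v\<in>set (contexts P). length v = demand P"
    using P by (auto simp: valid_problem_def valuations_def)
  then have "\<forall>i<length (contexts P). \<forall>a\<le>demand P. \<forall>b\<le>demand P. rmem \<sigma> (''S'', [i, a, b]) =
           rmem \<rho> (''S'', [i, a, b]) + edge_value (units P) (contexts P ! i) (\<beta> t) a b"
    using wp_update[of "update_input P v (\<beta> t)" P "demand P" "contexts P" "units P" "\<beta> t" \<rho>] \<sigma>
    by (auto simp: wp_def hedge_algorithm_def update_input_def)
  ultimately have "state_invariant P \<beta> (Suc t) \<sigma>"
    using Suc.IH[OF \<sigma>\<^sub>0] by (auto simp: state_invariant_def cumulative_def)
  with 1 2 show ?case by (simp add: programs_def)
qed

lemma resource_bounds:
  obtains c d where "\<And>P F \<beta> t \<sigma>. valid_problem P \<Longrightarrow> set_pmf F \<subseteq> set (contexts P) \<Longrightarrow>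
    \<sigma> \<in> set_pmf (after_rounds hedge_algorithm P F \<beta> (Suc t)) \<Longrightarrow>
    steps \<sigma> \<le> c * (strat_bound P + demand P + length (contexts P)) ^ d \<and>
    space_used \<sigma> \<le> c * (strat_bound P + demand P + length (contexts P)) ^ d"
proof -
  obtain k d where kd: "\<And>B. 1 \<le> B \<Longrightarrow> cost B programs \<le> k * B ^ d"
    using cost_polynomial[of programs] by blast
  \<comment> \<open>A common exponent for the degree of the running time and the cubic number of
    cells.\<close>
  define e where "e = d + 3"
  define q where "q = card (nvars programs) + card (rvars programs)"
  define c where "c = k * 2 ^ e + q * 4 * 2 ^ e"
  have "steps \<sigma> \<le> c * (strat_bound P + demand P + length (contexts P)) ^ e \<and>
    space_used \<sigma> \<le> c * (strat_bound P + demand P + length (contexts P)) ^ e"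
    if "valid_problem P" "set_pmf F \<subseteq> set (contexts P)"
      "\<sigma> \<in> set_pmf (after_rounds hedge_algorithm P F \<beta> (Suc t))" for P F \<beta> t \<sigma>
  proof -
    let ?N = "strat_bound P + demand P + length (contexts P)"
    let ?B = "size_bound P"
    \<comment> \<open>Here \<open>?B + 1\<close> equals N + 2, and N >= 2 because m and M are
      positive.\<close>
    have N: "?B + 1 \<le> 2 * ?N" "1 \<le> ?B" using that(1) by (auto simp: valid_problem_def size_bound_def)
    have inv: "bounded_config ?B (nvars programs) (rvars programs) \<sigma>" "steps \<sigma> \<le> cost ?B programs"
      using after_rounds_invariant[OF that] by auto
    have "(?B + 1) ^ e \<le> (2 * ?N) ^ e" using N by (intro power_mono) auto
    then have B: "(?B + 1) ^ e \<le> 2 ^ e * ?N ^ e" by (simp only: power_mult_distrib)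
    have "steps \<sigma> \<le> k * ?B ^ d" using inv(2) kd[OF N(2)] by linarith
    also have "?B ^ d \<le> (?B + 1) ^ d" by (intro power_mono) auto
    also have "(?B + 1) ^ d \<le> (?B + 1) ^ e" by (intro power_increasing) (auto simp: e_def)
    also note B
    finally have 1: "steps \<sigma> \<le> k * 2 ^ e * ?N ^ e" by (simp add: mult.assoc)
    have "space_used \<sigma> \<le> card (cells (nvars programs) ?B) + card (cells (rvars programs) ?B)"
      unfolding space_used_def using inv(1)
      by (intro add_mono card_mono card_cells_le(1) finite_vars) (auto simp: bounded_config_def)
    also have "\<dots> \<le> q * (4 * (?B + 1) ^ 3)"
      unfolding q_def add_mult_distrib by (intro add_mono card_cells_le(2) finite_vars)
    also have "(?B + 1) ^ 3 \<le> (?B + 1) ^ e" by (intro power_increasing) (auto simp: e_def)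
    also note B
    finally have 2: "space_used \<sigma> \<le> q * 4 * 2 ^ e * ?N ^ e" by (simp add: mult.assoc)
    show ?thesis
      using 1 2 by (simp add: c_def add_mult_distrib)
  qed
  then show thesis by (rule that)
qed

text \<open>All memories reachable before the round yield the same edge weights, so averaging over
  them has no effect.\<close>

lemma bids_in_round_hedge_algorithm:
  assumes P: "valid_problem P" and F: "set_pmf F \<subseteq> set (contexts P)"
  shows "bids_in_round hedge_algorithm P F \<beta> t =
    bind_pmf F (\<lambda>v. map_pmf (\<lambda>bs. (v, path_strategy (avg_value v) 0 bs)) (hedge_paths P \<beta> t v))"
    (is "_ = ?D")
proof -
  have *: "map_pmf submitted (exec (bid_input P v) (bid_prog hedge_algorithm) (\<sigma>\<lparr>steps := 0\<rparr>)) =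
      map_pmf (path_strategy (avg_value v) 0) (hedge_paths P \<beta> t v)"
    if \<sigma>: "\<sigma> \<in> set_pmf (after_rounds hedge_algorithm P F \<beta> t)" and "v \<in> set_pmf F" for \<sigma> v
  proof -
    obtain i where i: "i < length (contexts P)" "v = contexts P ! i"
      using F \<open>v \<in> set_pmf F\<close> by (auto simp: in_set_conv_nth dest!: subsetD)
    have "sample (demand P) (edge_weight P v (\<lambda>a b. rmem (\<sigma>\<lparr>steps := 0\<rparr>) (''S'', [i, a, b]))) (demand P) 0 (strat_bound P) =
        hedge_paths P \<beta> t v"
      unfolding hedge_paths_def
      using after_rounds_invariant[OF P F \<sigma>] i
      by (intro sample_cong) (auto simp: edge_weight_def state_invariant_def)
    then show ?thesis using map_bid_prog[OF P i] by simp
  qed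
  have "bids_in_round hedge_algorithm P F \<beta> t =
      bind_pmf (after_rounds hedge_algorithm P F \<beta> t) (\<lambda>\<sigma>. bind_pmf F (\<lambda>v. map_pmf (Pair v)
        (map_pmf submitted (exec (bid_input P v) (bid_prog hedge_algorithm) (\<sigma>\<lparr>steps := 0\<rparr>)))))"
    by (simp add: bids_in_round_def bid_phase_def map_pmf_def bind_assoc_pmf bind_return_pmf)
  also have "\<dots> = bind_pmf (after_rounds hedge_algorithm P F \<beta> t) (\<lambda>\<sigma>. ?D)"
    by (intro bind_pmf_cong refl) (simp add: * map_pmf_comp)
  finally show ?thesis by simp
qed

section \<open>Admissibility of the sampled strategies\<close>

lemma edge_weight_nonneg: "0 \<le> edge_weight P v S a b"
  by (simp add: edge_weight_def)

lemma path_total_pos: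
  assumes "avg_strategies (strat_bound P) v \<noteq> {}" "length v = demand P"
  shows "0 < path_total (demand P) (edge_weight P v S) (demand P) 0 (strat_bound P)"
proof -
  obtain bs where bs: "bs \<in> paths (demand P) (demand P) 0 (strat_bound P)" "path_ok v 0 bs"
    using assms(1) avg_strategies_path[OF _ assms(2)] by blast
  have "0 < path_weight (edge_weight P v S) 0 bs"
    using bs by (simp add: path_weight_edge_weight)
  also have "\<dots> \<le> (\<Sum>bs\<in>paths (demand P) (demand P) 0 (strat_bound P). path_weight (edge_weight P v S) 0 bs)"
    using bs by (intro member_le_sum) (auto simp: finite_paths path_weight_nonneg edge_weight_nonneg)
  finally show ?thesis by (simp add: path_total_eq_sum)
qed

lemma hedge_paths_support:
  assumes v: "length v = demand P" and bs: "bs \<in> set_pmf (hedge_paths P \<beta> t v)"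
    and "avg_strategies (strat_bound P) v \<noteq> {}"
  shows "bs \<in> paths (demand P) (demand P) 0 (strat_bound P)" "path_ok v 0 bs"
  using set_sample[OF edge_weight_nonneg order_refl path_total_pos[OF assms(3,1)] bs[unfolded hedge_paths_def]]
  by (auto simp: path_weight_edge_weight split: if_splits)

lemma hedge_paths_degenerate:
  assumes v: "length v = demand P" and "avg_strategies (strat_bound P) v = {}"
  shows "hedge_paths P \<beta> t v = return_pmf []"
proof -
  let ?E = "edge_weight P v (cumulative P \<beta> t v)"
  have "path_weight ?E 0 bs = 0" if "bs \<in> paths (demand P) (demand P) 0 (strat_bound P)" for bs
    using path_strategy_admissible[OF that _ v] assms(2) by (auto simp: path_weight_edge_weight)
  then have "path_total (demand P) ?E (demand P) 0 (strat_bound P) = 0"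
    by (simp add: path_total_eq_sum)
  then show ?thesis
    unfolding hedge_paths_def by (intro sample_degenerate edge_weight_nonneg)
qed

lemma hedge_paths_admissible:
  assumes "length v = demand P" "bs \<in> set_pmf (hedge_paths P \<beta> t v)"
  shows "path_strategy (avg_value v) 0 bs \<in> admissible (strat_bound P) v"
proof (cases "avg_strategies (strat_bound P) v = {}")
  case True
  then show ?thesis using assms hedge_paths_degenerate by (simp add: admissible_def)
next
  case False
  then show ?thesis
    using hedge_paths_support[OF assms False] path_strategy_admissible assms(1) by (simp add: admissible_def)
qed

text \<open>With q = sqrt (m ln M) and s = sqrt T, the rate is q / (s M). As M + 1 <= M^2 for M >=
  2, ln n <= 2 q^2, and the two terms are at most 2 M q s and M q s / 2.\<close>

lemma learning_rate_tuning:
  fixes m M T n :: nat and \<eta> :: real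
  assumes "2 \<le> M" "1 \<le> m" "1 \<le> T" "1 \<le> n" "n \<le> (M + 1) ^ m"
    and "\<eta> = sqrt (real m * ln (real M) / real T) / real M"
  shows "0 < \<eta>" "ln (real n) / \<eta> + \<eta> * real T * (real M)\<^sup>2 / 2
    \<le> 3 * real M * sqrt (real m * real T * ln (real M))"
proof -
  define q where "q = sqrt (real m * ln (real M))"
  define s where "s = sqrt (real T)"
  have q: "0 < q" "q\<^sup>2 = real m * ln (real M)" and s: "0 < s" "s\<^sup>2 = real T" and M: "0 < real M"
    using assms by (auto simp: q_def s_def)
  have \<eta>: "\<eta> = q / (s * real M)" using assms(6) by (simp add: q_def s_def real_sqrt_divide)
  then show "0 < \<eta>" using q s M by simp
  have "M + 1 \<le> M ^ 2" using mult_le_mono1[OF assms(1), of M] assms(1) unfolding power2_eq_square by linarith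
  then have "n \<le> (M ^ 2) ^ m" using assms(5) by (meson le_trans power_mono zero_le)
  then have "real n \<le> real M ^ (2 * m)" by (simp add: power_mult flip: of_nat_power)
  then have "ln (real n) \<le> ln (real M ^ (2 * m))" using assms by (subst ln_le_cancel_iff) auto
  also have "\<dots> = 2 * q\<^sup>2" using M by (simp add: ln_realpow q(2))
  finally have "ln (real n) / \<eta> \<le> 2 * q\<^sup>2 / \<eta>" using \<open>0 < \<eta>\<close> by (intro divide_right_mono) auto
  also have "2 * q\<^sup>2 / \<eta> = 2 * (real M * (q * s))"
    using q(1) s(1) M by (simp add: \<eta> field_simps power2_eq_square)
  finally have "ln (real n) / \<eta> \<le> 2 * (real M * (q * s))" .
  moreover have "\<eta> * real T * (real M)\<^sup>2 / 2 = real M * (q * s) / 2"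
    using q(1) s(1) M by (simp add: \<eta> s(2)[symmetric] field_simps power2_eq_square)
  moreover have "0 \<le> real M * (q * s)" using q s M by simp
  moreover have "q * s = sqrt (real m * real T * ln (real M))"
    by (simp add: q_def s_def mult_ac flip: real_sqrt_mult)
  ultimately show "ln (real n) / \<eta> + \<eta> * real T * (real M)\<^sup>2 / 2
    \<le> 3 * real M * sqrt (real m * real T * ln (real M))" by simp
qed

lemma context_regret:
  assumes P: "valid_problem P" and v: "v \<in> set (contexts P)" and \<beta>: "\<forall>t<horizon P. \<beta> t \<in> competing_bids"
    and s: "s \<in> admissible (strat_bound P) v"
  shows "(\<Sum>t<horizon P. auction_value (units P) v s (\<beta> t)) -
      (\<Sum>t<horizon P. measure_pmf.expectation (hedge_paths P \<beta> t v)
         (\<lambda>bs. auction_value (units P) v (path_strategy (avg_value v) 0 bs) (\<beta> t)))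
    \<le> 3 * real (demand P) * sqrt (real (strat_bound P) * real (horizon P) * ln (real (demand P)))"
    (is "_ - (\<Sum>t<_. ?ex t) \<le> ?R")
proof -
  define M where "M = demand P"
  define m where "m = strat_bound P"
  define T where "T = horizon P"
  define K where "K = units P"
  have bounds: "1 \<le> M" "1 \<le> m" "1 \<le> T" and val: "v \<in> valuations M"
    using P v by (auto simp: valid_problem_def M_def m_def T_def)
  then have len: "length v = M" by (simp add: valuations_def)
  have R: "0 \<le> ?R" using bounds by (auto simp: M_def)
  show ?thesis
  proof (cases "avg_strategies m v = {}")
    \<comment> \<open>Comparator and learner both submit the empty strategy, so the difference is
      0.\<close>
    case True
    then show ?thesis
      using s R hedge_paths_degenerate[of v P] len by (simp add: admissible_def m_def M_def)
  next
    case False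
    then obtain bs\<^sub>0 where bs\<^sub>0: "bs\<^sub>0 \<in> paths M M 0 m" "path_ok v 0 bs\<^sub>0" "s = path_strategy (avg_value v) 0 bs\<^sub>0"
      using s avg_strategies_path[of s m v M] len by (auto simp: admissible_def m_def)
    define X where "X = {bs \<in> paths M M 0 m. path_ok v 0 bs}"
    define g where "g t bs = path_sum (edge_value K v (\<beta> t)) 0 bs" for t bs
    have gain: "auction_value K v (path_strategy (avg_value v) 0 bs) (\<beta> t) = g t bs" if "bs \<in> X" "t < T" for bs t
      using auction_value_path_strategy[of bs M m v "\<beta> t" K] that len \<beta> by (simp add: X_def g_def T_def)
    show ?thesis
    proof (cases "M = 1")
      case True
      \<comment> \<open>For M = 1 the learning rate is 0 and the Hedge bound does not apply, but the
        learner already plays the only strategy.\<close>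
      have single: "bs = [1]" if "bs \<in> paths 1 1 0 m" for bs
      proof (cases bs)
        case (Cons b cs)
        with that show ?thesis by (cases cs) (auto simp: paths_def)
      qed (use that in \<open>simp add: paths_def\<close>)
      have "?ex t = auction_value K v s (\<beta> t)" for t
      proof -
        have "path_strategy (avg_value v) 0 bs = s" if "bs \<in> set_pmf (hedge_paths P \<beta> t v)" for bs
          using hedge_paths_support(1)[OF _ that] False len single[of bs] single[of bs\<^sub>0] bs\<^sub>0 \<open>M = 1\<close>
          by (simp add: M_def m_def)
        then have "?ex t = measure_pmf.expectation (hedge_paths P \<beta> t v) (\<lambda>bs. auction_value K v s (\<beta> t))"
          by (intro integral_cong_AE) (auto simp: AE_measure_pmf_iff K_def)
        then show ?thesis by simp
      qed
      then show ?thesis using R by (simp add: K_def)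
    next
      case False
      with bounds have M: "2 \<le> M" by simp
      define \<eta> where "\<eta> = learning_rate P"
      define W where "W t bs = exp (\<eta> * (\<Sum>s<t. g s bs))" for t bs
      \<comment> \<open>The expected value of the sampled strategy is the Hedge average over the
        admissible paths, all others having weight 0.\<close>
      have ex: "?ex t = (\<Sum>bs\<in>X. W t bs * g t bs) / (\<Sum>bs\<in>X. W t bs)" if t: "t < T" for t
      proof -
        let ?E = "edge_weight P v (cumulative P \<beta> t v)"
        have W: "path_weight ?E 0 bs = (if path_ok v 0 bs then W t bs else 0)" for bs
          by (simp add: path_weight_edge_weight W_def g_def \<eta>_def cumulative_def[abs_def] path_sum_sum K_def)
        have sum: "(\<Sum>bs\<in>paths M M 0 m. path_weight ?E 0 bs * f bs) = (\<Sum>bs\<in>X. W t bs * f bs)" for f :: "nat list \<Rightarrow> real"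
          unfolding X_def sum.inter_filter[OF finite_paths[OF order_refl]]
          by (intro sum.cong) (auto simp: W)
        have total: "path_total M ?E M 0 m = (\<Sum>bs\<in>X. W t bs)"
          using sum[of "\<lambda>_. 1"] by (simp add: path_total_eq_sum)
        have "0 < path_total M ?E M 0 m"
          using path_total_pos[of P v] \<open>avg_strategies m v \<noteq> {}\<close> len by (simp add: M_def m_def)
        then have "?ex t = (\<Sum>bs\<in>X. W t bs * auction_value K v (path_strategy (avg_value v) 0 bs) (\<beta> t)) / (\<Sum>bs\<in>X. W t bs)"
          unfolding hedge_paths_def M_def[symmetric] m_def[symmetric] K_def[symmetric]
          by (subst expectation_sample) (simp_all add: edge_weight_nonneg sum total)
        also have "(\<Sum>bs\<in>X. W t bs * auction_value K v (path_strategy (avg_value v) 0 bs) (\<beta> t)) = (\<Sum>bs\<in>X. W t bs * g t bs)"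
          using gain t by (intro sum.cong) auto
        finally show ?thesis .
      qed
      have X: "finite X" "bs\<^sub>0 \<in> X" using bs\<^sub>0 by (auto simp: X_def finite_paths)
      have "card X \<le> card (paths M M 0 m)" by (intro card_mono finite_paths) (auto simp: X_def)
      also have "\<dots> \<le> (M + 1) ^ m" by (rule card_paths_le) simp
      finally have card: "card X \<le> (M + 1) ^ m" .
      have "1 \<le> card X" using X by (auto simp: card_gt_0_iff Suc_le_eq)
      note tuning = learning_rate_tuning[OF M bounds(2,3) this card, of \<eta>]
      have \<eta>: "\<eta> = sqrt (real m * ln (real M) / real T) / real M"
        by (simp add: \<eta>_def learning_rate_def m_def M_def T_def)
      have "(\<Sum>t<T. auction_value K v s (\<beta> t)) - (\<Sum>t<T. ?ex t) =
          (\<Sum>t<T. g t bs\<^sub>0) - (\<Sum>t<T. (\<Sum>bs\<in>X. W t bs * g t bs) / (\<Sum>bs\<in>X. W t bs))"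
        using ex gain[OF X(2)] bs\<^sub>0(3) by simp
      also have "\<dots> \<le> ln (real (card X)) / \<eta> + \<eta> * real T * (real M)\<^sup>2 / 2"
        unfolding W_def
      proof (rule hedge_regret[OF X tuning(1)[OF \<eta>]])
        fix t bs assume "t < T" "bs \<in> X"
        then show "0 \<le> g t bs \<and> g t bs \<le> real M"
          using auction_value_bounds[OF val] gain by metis
      qed
      also have "\<dots> \<le> 3 * real M * sqrt (real m * real T * ln (real M))"
        by (rule tuning(2)[OF \<eta>])
      finally show ?thesis by (simp add: M_def m_def T_def K_def)
    qed
  qed
qed

text \<open>Both values are averages over F of sums for a fixed context, because a policy picks each
  strategy separately and the law of the bids given the context is deterministic in the history. The
  bound per context is uniform, so it survives the average and the maximum over policies.\<close>

lemma stochastic_regret_hedge_algorithm: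
  assumes P: "valid_problem P" and F: "set_pmf F \<subseteq> set (contexts P)" and \<beta>: "\<forall>t<horizon P. \<beta> t \<in> competing_bids"
  shows "stochastic_regret hedge_algorithm P F \<beta>
    \<le> 3 * real (demand P) * sqrt (real (strat_bound P) * real (horizon P) * ln (real (demand P)))" (is "_ \<le> ?R")
proof -
  let ?V = "set (contexts P)"
  let ?ex = "\<lambda>t v. measure_pmf.expectation (hedge_paths P \<beta> t v)
      (\<lambda>bs. auction_value (units P) v (path_strategy (avg_value v) 0 bs) (\<beta> t))"
  have alg: "algorithm_value hedge_algorithm P F \<beta> = (\<Sum>v\<in>?V. pmf F v * (\<Sum>t<horizon P. ?ex t v))"
  proof -
    have "algorithm_value hedge_algorithm P F \<beta> = (\<Sum>t<horizon P. \<Sum>v\<in>?V. pmf F v * ?ex t v)"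
      unfolding algorithm_value_def bids_in_round_hedge_algorithm[OF P F]
      by (intro sum.cong refl, subst pmf_expectation_bind[where A = ?V])
        (use F in \<open>auto simp: hedge_paths_def finite_set_sample\<close>)
    then show ?thesis by (subst (asm) sum.swap) (simp add: sum_distrib_left)
  qed
  have "policy_value P F \<beta> \<pi> - algorithm_value hedge_algorithm P F \<beta> \<le> ?R" if \<pi>: "\<pi> \<in> policies P" for \<pi>
  proof -
    have "policy_value P F \<beta> \<pi> = (\<Sum>t<horizon P. \<Sum>v\<in>?V. pmf F v * auction_value (units P) v (\<pi> v) (\<beta> t))"
      unfolding policy_value_def using F
      by (intro sum.cong refl, subst integral_measure_pmf[where A = ?V]) auto
    then have "policy_value P F \<beta> \<pi> = (\<Sum>v\<in>?V. pmf F v * (\<Sum>t<horizon P. auction_value (units P) v (\<pi> v) (\<beta> t)))"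
      by (subst (asm) sum.swap) (simp add: sum_distrib_left)
    then have "policy_value P F \<beta> \<pi> - algorithm_value hedge_algorithm P F \<beta> =
        (\<Sum>v\<in>?V. pmf F v * ((\<Sum>t<horizon P. auction_value (units P) v (\<pi> v) (\<beta> t)) - (\<Sum>t<horizon P. ?ex t v)))"
      by (simp add: alg sum_subtractf right_diff_distrib)
    also have "\<dots> \<le> (\<Sum>v\<in>?V. pmf F v * ?R)"
      using \<pi> by (intro sum_mono mult_left_mono context_regret[OF P _ \<beta>]) (auto simp: policies_def)
    also have "\<dots> = ?R"
      using F by (simp add: sum_pmf_eq_1 flip: sum_distrib_right)
    finally show ?thesis .
  qed
  then have "(MAX \<pi>\<in>policies P. policy_value P F \<beta> \<pi>) \<le> ?R + algorithm_value hedge_algorithm P F \<beta>"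
    using finite_policies policies_nonempty by (intro Max.boundedI) (auto simp: algebra_simps)
  then show ?thesis by (simp add: stochastic_regret_def)
qed

theorem mainTheorem17:
  shows "\<exists>(A :: algorithm) (C :: real) (c :: nat) (d :: nat). C > 0 \<and>
    (\<forall>(P :: problem) (F :: valuation pmf) (\<beta> :: nat \<Rightarrow> real list).
       valid_problem P \<and> set_pmf F \<subseteq> set (contexts P) \<and> (\<forall>t<horizon P. \<beta> t \<in> competing_bids) \<longrightarrow>
       (\<forall>t<horizon P. \<forall>(v, s)\<in>set_pmf (bids_in_round A P F \<beta> t). s \<in> admissible (strat_bound P) v) \<and>
       (\<forall>t<horizon P. \<forall>\<sigma>\<in>set_pmf (after_rounds A P F \<beta> (Suc t)).
          steps \<sigma> \<le> c * (strat_bound P + demand P + length (contexts P)) ^ d \<and>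
          space_used \<sigma> \<le> c * (strat_bound P + demand P + length (contexts P)) ^ d) \<and>
       stochastic_regret A P F \<beta>
         \<le> C * real (demand P) *
             sqrt (real (strat_bound P) * real (horizon P) * ln (real (demand P))))"
proof -
  obtain c d where cd: "\<And>P F \<beta> t \<sigma>. valid_problem P \<Longrightarrow> set_pmf F \<subseteq> set (contexts P) \<Longrightarrow>
    \<sigma> \<in> set_pmf (after_rounds hedge_algorithm P F \<beta> (Suc t)) \<Longrightarrow>
    steps \<sigma> \<le> c * (strat_bound P + demand P + length (contexts P)) ^ d \<and>
    space_used \<sigma> \<le> c * (strat_bound P + demand P + length (contexts P)) ^ d"
    using resource_bounds by blast
  have adm: "s \<in> admissible (strat_bound P) v"
    if "valid_problem P" "set_pmf F \<subseteq> set (contexts P)" "(v, s) \<in> set_pmf (bids_in_round hedge_algorithm P F \<beta> t)"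
    for P F \<beta> t v s
  proof -
    have "\<forall>v\<in>set_pmf F. length v = demand P"
      using that(1,2) by (auto simp: valid_problem_def valuations_def)
    then show ?thesis
      using that(3) hedge_paths_admissible by (auto simp: bids_in_round_hedge_algorithm[OF that(1,2)])
  qed
  show ?thesis
    by (rule exI[of _ hedge_algorithm], rule exI[of _ "3 :: real"], rule exI[of _ c], rule exI[of _ d])
      (use cd adm stochastic_regret_hedge_algorithm in \<open>auto simp del: after_rounds.simps\<close>)
qed

end
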